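(* Let $n\ge 3$ and $2<r<n$. Any translation hypersurface in $\mathbb{R}^{n+1}$ with $S_r$ constant must have $S_r=0$.
   Context: A hypersurface $M^n$ of the Euclidean space $\mathbb{R}^{n+1}$ is a translation hypersurface if it is the graph of a function of the form $F(x_1,\ldots,x_n)=f_1(x_1)+\cdots+f_n(x_n)$, where $(x_1,\ldots,x_n)$ are cartesian coordinates and each $f_i$ is a smooth function of one real variable. For an oriented hypersurface $M^n\subset\mathbb{R}^{n+1}$ with principal curvatures $\lambda_1,\ldots,\lambda_n$ (eigenvalues of the shape operator), the $S_r$ curvature is $S_r=\sum_{1\le i_1<\cdots<i_r\le n}\lambda_{i_1}\cdots\lambda_{i_r}$, the $r$-th elementary symmetric polynomial of the principal curvatures, without normalization. *)

theory Defs
  imports "HOL-Analysis.Analysis"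
begin

text \<open>
  Euclidean (n+1)-space is the product \<open>(real ^ 'n) \<times> real\<close> with its standard inner
  product, where n = \<open>CARD('n)\<close>; the last coordinate is the height of a graph.
\<close>

text \<open>Only meaningful for open \<open>I\<close>, where the iterated \<open>deriv\<close> depends only on \<open>g\<close> on \<open>I\<close>.\<close>

definition smooth_real_on :: "(real \<Rightarrow> real) \<Rightarrow> real set \<Rightarrow> bool" where
  "smooth_real_on g I \<longleftrightarrow> (\<forall>k. (deriv ^^ k) g differentiable_on I)"

text \<open>
  The domain \<open>U\<close> of the height function may be any nonempty connected open set (all of
  n-space and products of open intervals included); its i-th coordinate projection, on which
  \<open>f i\<close> has to be smooth, is then an open interval.
\<close>

definition translation_hypersurface :: "((real ^ 'n) \<times> real) set \<Rightarrow> bool" where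
  "translation_hypersurface M \<longleftrightarrow>
    (\<exists>(U :: (real ^ 'n) set) (f :: 'n \<Rightarrow> real \<Rightarrow> real).
       open U \<and> connected U \<and> U \<noteq> {} \<and>
       (\<forall>i. smooth_real_on (f i) ((\<lambda>x. x $ i) ` U)) \<and>
       M = (\<lambda>x. (x, \<Sum>i\<in>UNIV. f i (x $ i))) ` U)"

definition tangent_space :: "'a::real_normed_vector set \<Rightarrow> 'a \<Rightarrow> 'a set" where
  "tangent_space M p =
    {v. \<exists>\<gamma> :: real \<Rightarrow> 'a. \<gamma> 0 = p \<and> (\<forall>\<^sub>F t in at 0. \<gamma> t \<in> M) \<and>
          (\<gamma> has_vector_derivative v) (at 0)}"

text \<open>An orientation of a hypersurface is a continuous unit normal field along it.\<close>

definition unit_normal_field :: "('a::euclidean_space \<Rightarrow> 'a) \<Rightarrow> 'a set \<Rightarrow> bool" where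
  "unit_normal_field N M \<longleftrightarrow>
    continuous_on M N \<and>
    (\<forall>p\<in>M. norm (N p) = 1 \<and> (\<forall>v\<in>tangent_space M p. N p \<bullet> v = 0))"

text \<open>
  The derivative of \<open>N\<close> within \<open>M\<close> is not unique as a linear map on the ambient space, but
  its values on tangent vectors are. The shape operator is therefore only applied to tangent
  vectors below.
\<close>

definition shape_operator ::
  "('a::euclidean_space \<Rightarrow> 'a) \<Rightarrow> 'a set \<Rightarrow> 'a \<Rightarrow> 'a \<Rightarrow> 'a" where
  "shape_operator N M p v = - frechet_derivative N (at p within M) v"

definition principal_space ::
  "('a::euclidean_space \<Rightarrow> 'a) \<Rightarrow> 'a set \<Rightarrow> 'a \<Rightarrow> real \<Rightarrow> 'a set" where
  "principal_space N M p \<kappa> = {v \<in> tangent_space M p. shape_operator N M p v = \<kappa> *\<^sub>R v}"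

text \<open>
  The eigenvalues of the shape operator, each listed as often as the dimension of its
  eigenspace. As the shape operator is self-adjoint on the n-dimensional tangent space, such
  a list of length n exists; it is unique up to the order, which is irrelevant for the
  symmetric function \<open>S_curvature\<close>.
\<close>

definition principal_curvatures ::
  "((real ^ 'n) \<times> real \<Rightarrow> (real ^ 'n) \<times> real) \<Rightarrow> ((real ^ 'n) \<times> real) set
    \<Rightarrow> (real ^ 'n) \<times> real \<Rightarrow> 'n \<Rightarrow> real" where
  "principal_curvatures N M p =
    (SOME \<mu>. \<forall>\<kappa>. card {i. \<mu> i = \<kappa>} = dim (principal_space N M p \<kappa>))"

definition S_curvature ::
  "nat \<Rightarrow> ((real ^ 'n) \<times> real \<Rightarrow> (real ^ 'n) \<times> real) \<Rightarrow> ((real ^ 'n) \<times> real) set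
    \<Rightarrow> (real ^ 'n) \<times> real \<Rightarrow> real" where
  "S_curvature r N M p =
    (\<Sum>J | card J = r. \<Prod>i\<in>J. principal_curvatures N M p i)"

end

theory Submission
  imports Defs "HOL-Computational_Algebra.Polynomial"
begin

text \<open>
  Let \<open>g\<close> and \<open>h\<close> be the vectors of first and second derivatives of the functions \<open>f i\<close> at \<open>x\<close>,
  so that \<open>g\<close> is the gradient of the height function and its Hessian is diagonal with entries \<open>h\<close>;
  write \<open>W\<^sup>2 = 1 + \<bar>g\<bar>\<^sup>2\<close>. The shape operator is, up to the sign \<open>\<epsilon>\<close> of the orientation, a rank-one
  perturbation of a diagonal operator, and expanding its characteristic polynomial gives
  (\<open>S_curvature_lift\<close>)
  \<open>S\<^sub>r * W ^ (r + 2) = \<epsilon> ^ r * (\<Sum>J | card J = r. (\<Prod>i\<in>J. h i) * (1 + (\<Sum>m\<in>-J. (g m)\<^sup>2)))\<close>.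
  Here \<open>\<epsilon>\<close> is globally constant because the domain is connected.

  Suppose that \<open>S\<^sub>r\<close> is a nonzero constant. Then some product of \<open>r \<ge> 2\<close> of the \<open>h i\<close> is nonzero
  at some point, so there are two coordinates \<open>i \<noteq> j\<close> whose slopes \<open>g i\<close> and \<open>g j\<close> are not
  locally constant. Freeze all the other coordinates. With \<open>x i = s\<close>, \<open>x j = u\<close> and
  \<open>t = (g i s)\<^sup>2\<close>, the right-hand side is affine in \<open>h i\<close> and \<open>t\<close>, and the equation reads
  \<open>h i s * P u + Q u + t * E u = c * (b u + t) powr q\<close> with \<open>q = (r + 2) / 2\<close>.
  On the left, letting \<open>u\<close> vary produces functions of \<open>s\<close> in the span of the three functions \<open>h i\<close>,
  \<open>1\<close> and \<open>t\<close>. On the right, \<open>b u\<close> takes infinitely many values, and any four shifted powers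
  \<open>(b + t) powr q\<close> with distinct shifts are linearly independent on an interval of values of \<open>t\<close>
  as soon as \<open>q\<close> is none of \<open>0, 1, 2\<close>. This is where \<open>r > 2\<close> enters: it says that \<open>q > 2\<close>. For
  \<open>r = 2\<close> the powers \<open>(b + t)\<^sup>2\<close> do span only a three-dimensional space.

  The multiplicities of the principal curvatures in terms of eigenspaces require the spectral
  theorem, which is proved for an operator that is self-adjoint on a subspace of a Euclidean space,
  so that it applies to a tangent space inside the ambient space.
\<close>

section \<open>Self-adjoint operators on a subspace\<close>

text \<open>
  A maximum point of the Rayleigh quotient on the compact unit sphere of \<open>T\<close> is an eigenvector.
\<close>

lemma self_adjoint_on_eigenvector:
  fixes A :: "'a::euclidean_space \<Rightarrow> 'a"
  assumes A: "linear A" and T: "subspace T" and T0: "T \<noteq> {0}"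
    and inv: "\<And>x. x \<in> T \<Longrightarrow> A x \<in> T"
    and sym: "\<And>x y. x \<in> T \<Longrightarrow> y \<in> T \<Longrightarrow> A x \<bullet> y = x \<bullet> A y"
  obtains b \<kappa> where "b \<in> T" "norm b = 1" "A b = \<kappa> *\<^sub>R b"
proof -
  let ?S = "T \<inter> sphere 0 1"
  interpret A: linear A by fact
  obtain z where z: "z \<in> T" "z \<noteq> 0"
    using T0 subspace_0[OF T] by blast
  have "(1 / norm z) *\<^sub>R z \<in> ?S"
    using z by (simp add: subspace_mul[OF T])
  then have ne: "?S \<noteq> {}" by blast
  have "compact ?S"
    by (simp add: T closed_Int_compact closed_subspace)
  moreover have "continuous_on ?S (\<lambda>x. A x \<bullet> x)"
    by (intro continuous_intros linear_continuous_on) (use A linear_conv_bounded_linear in blast)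
  ultimately obtain b where b: "b \<in> ?S" and bmax: "\<And>y. y \<in> ?S \<Longrightarrow> A y \<bullet> y \<le> A b \<bullet> b"
    using continuous_attains_sup ne by (metis (no_types, lifting))
  have bT: "b \<in> T" and b1: "norm b = 1" using b by auto
  have bb: "b \<bullet> b = 1" using b1 by (simp add: dot_square_norm)
  define \<kappa> where "\<kappa> = A b \<bullet> b"
  have nonneg: "0 \<le> \<kappa> * (y \<bullet> y) - A y \<bullet> y" if y: "y \<in> T" for y
  proof (cases "y = 0")
    case True
    then show ?thesis by simp
  next
    case False
    have "(1 / norm y) *\<^sub>R y \<in> ?S"
      using False y by (simp add: subspace_mul[OF T])
    from bmax[OF this] have "A y \<bullet> y / (norm y * norm y) \<le> \<kappa>"
      by (simp add: A.scale \<kappa>_def divide_simps)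
    then show ?thesis
      using False by (simp add: divide_simps dot_square_norm power2_eq_square)
  qed
  \<comment> \<open>The form in \<open>nonneg\<close> vanishes at its minimum \<open>b\<close>, so its first variation at \<open>b\<close> in the
    direction \<open>w\<close>, which is \<open>2 * (w \<bullet> w)\<close>, vanishes too.\<close>
  define w where "w = \<kappa> *\<^sub>R b - A b"
  have wT: "w \<in> T"
    unfolding w_def by (intro subspace_diff subspace_mul T bT inv)
  define m where "m = \<kappa> * (w \<bullet> w) - A w \<bullet> w"
  have expand: "\<kappa> * ((b + t *\<^sub>R w) \<bullet> (b + t *\<^sub>R w)) - A (b + t *\<^sub>R w) \<bullet> (b + t *\<^sub>R w)
      = 2 * t * (w \<bullet> w) + t\<^sup>2 * m" for t
  proof -
    have w2: "w \<bullet> w = \<kappa> * (b \<bullet> w) - A b \<bullet> w"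
      using arg_cong[OF w_def, of "\<lambda>z. z \<bullet> w"] by (simp add: inner_diff_left)
    have "A w \<bullet> b = A b \<bullet> w"
      using sym[OF wT bT] by (simp add: inner_commute)
    then have "\<kappa> * ((b + t *\<^sub>R w) \<bullet> (b + t *\<^sub>R w)) - A (b + t *\<^sub>R w) \<bullet> (b + t *\<^sub>R w)
      = 2 * t * (\<kappa> * (b \<bullet> w) - A b \<bullet> w) + t\<^sup>2 * m"
      using bb
      by (simp add: A.add A.scale inner_add_left inner_add_right \<kappa>_def[symmetric] m_def
          power2_eq_square inner_commute[of w b] algebra_simps)
    then show ?thesis by (simp only: w2)
  qed
  have "w \<bullet> w = 0"
  proof (rule ccontr)
    assume "w \<bullet> w \<noteq> 0"
    then have wp: "w \<bullet> w > 0" by simp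
    \<comment> \<open>A negative step so small that the linear term in \<open>expand\<close> dominates the quadratic one.\<close>
    define t where "t = - (w \<bullet> w) / (\<bar>m\<bar> + 1)"
    have tM: "t * (\<bar>m\<bar> + 1) = - (w \<bullet> w)"
      using abs_ge_zero[of m] by (simp add: t_def)
    have tneg: "t < 0" using wp by (simp add: t_def divide_less_0_iff)
    have "0 \<le> 2 * t * (w \<bullet> w) + t\<^sup>2 * m"
      using nonneg[of "b + t *\<^sub>R w"] expand[of t] bT wT T
      by (simp add: subspace_add subspace_mul)
    also have "\<dots> \<le> 2 * t * (w \<bullet> w) + t\<^sup>2 * (\<bar>m\<bar> + 1)"
      by (intro add_left_mono mult_left_mono) auto
    also have "\<dots> = t * (w \<bullet> w)"
      by (simp only: power2_eq_square mult.assoc tM)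
    also have "\<dots> < 0"
      using tneg wp by (simp add: mult_neg_pos)
    finally show False by simp
  qed
  then have "A b = \<kappa> *\<^sub>R b" by (simp add: w_def)
  with bT b1 that show thesis by blast
qed

text \<open>
  The orthogonal complement in \<open>T\<close> of an eigenvector is again invariant and has smaller dimension.
\<close>

lemma self_adjoint_on_eigenbasis:
  fixes A :: "'a::euclidean_space \<Rightarrow> 'a"
  assumes A: "linear A" and T: "subspace T"
    and inv: "\<And>x. x \<in> T \<Longrightarrow> A x \<in> T"
    and sym: "\<And>x y. x \<in> T \<Longrightarrow> y \<in> T \<Longrightarrow> A x \<bullet> y = x \<bullet> A y"
  shows "\<exists>B. independent B \<and> span B = T \<and> (\<forall>b\<in>B. \<exists>\<kappa>. A b = \<kappa> *\<^sub>R b)"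
proof -
  have "\<exists>B. pairwise orthogonal B \<and> 0 \<notin> B \<and> span B = T \<and> (\<forall>b\<in>B. \<exists>\<kappa>. A b = \<kappa> *\<^sub>R b)"
    using T inv sym
  proof (induction "dim T" arbitrary: T rule: less_induct)
    case less
    show ?case
    proof (cases "T = {0}")
      case True
      then show ?thesis by (intro exI[of _ "{}"]) auto
    next
      case False
      obtain b \<kappa> where b: "b \<in> T" "norm b = 1" "A b = \<kappa> *\<^sub>R b"
        using self_adjoint_on_eigenvector[OF A less.prems(1) False] less.prems(2,3) by blast
      have bb: "b \<bullet> b = 1" using b(2) by (simp add: dot_square_norm)
      define T' where "T' = {y \<in> T. b \<bullet> y = 0}"
      have T': "subspace T'"
        using less.prems(1) by (auto simp: T'_def subspace_def inner_add_right)
      have "T' \<subset> T" using b(1) bb by (force simp: T'_def)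
      then have "dim T' < dim T"
        by (metis T' dim_psubset less.prems(1) span_eq_iff)
      moreover have "A x \<in> T'" if "x \<in> T'" for x
        using that less.prems(2)[of x] less.prems(3)[OF b(1), of x] b
        by (auto simp: T'_def)
      moreover have "A x \<bullet> y = x \<bullet> A y" if "x \<in> T'" "y \<in> T'" for x y
        using that less.prems(3) by (auto simp: T'_def)
      ultimately obtain B where B: "pairwise orthogonal B" "0 \<notin> B" "span B = T'"
          "\<forall>b\<in>B. \<exists>\<kappa>. A b = \<kappa> *\<^sub>R b"
        using less.hyps[of T'] T' by blast
      have orth: "b \<bullet> y = 0" if "y \<in> B" for y
        using that B(3) span_base[of y B] by (auto simp: T'_def)
      have "span (insert b B) = T"
      proof
        show "span (insert b B) \<subseteq> T"
          using b(1) B(3) span_superset[of B] less.prems(1) by (intro span_minimal) (auto simp: T'_def)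
        show "T \<subseteq> span (insert b B)"
        proof
          fix y assume y: "y \<in> T"
          have "y - (b \<bullet> y) *\<^sub>R b \<in> T'"
            using y b(1) bb less.prems(1)
            by (auto simp: T'_def inner_diff_right subspace_diff subspace_mul)
          then show "y \<in> span (insert b B)"
            using B(3) by (auto simp: span_insert)
        qed
      qed
      moreover have "pairwise orthogonal (insert b B)"
        using B(1) orth by (auto simp: pairwise_insert orthogonal_def inner_commute)
      ultimately show ?thesis
        using B(2,4) b by (intro exI[of _ "insert b B"]) auto
    qed
  qed
  then show ?thesis
    using pairwise_orthogonal_independent by blast
qed

lemma independent_range_coeffs_zero:
  fixes b :: "'i::finite \<Rightarrow> 'a::real_vector"
  assumes "inj b" "independent (range b)" "(\<Sum>i\<in>UNIV. c i *\<^sub>R b i) = 0"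
  shows "c i = 0"
proof -
  have "(\<Sum>x\<in>range b. c (inv b x) *\<^sub>R x) = 0"
    using assms(1,3) by (simp add: sum.reindex)
  then have "c (inv b (b i)) = 0"
    using assms(2) independentD[of "range b" "range b" "\<lambda>x. c (inv b x)" "b i"] by auto
  then show ?thesis using assms(1) by simp
qed

lemma dim_eigenspace:
  fixes A :: "'a::euclidean_space \<Rightarrow> 'a" and b :: "'i::finite \<Rightarrow> 'a"
  assumes A: "linear A" and b: "inj b" "independent (range b)"
    and eig: "\<And>i. A (b i) = \<mu> i *\<^sub>R b i"
  shows "dim {v \<in> span (range b). A v = \<kappa> *\<^sub>R v} = card {i. \<mu> i = \<kappa>}"
proof -
  interpret A: linear A by fact
  have "{v \<in> span (range b). A v = \<kappa> *\<^sub>R v} = span (b ` {i. \<mu> i = \<kappa>})"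
  proof
    show "{v \<in> span (range b). A v = \<kappa> *\<^sub>R v} \<subseteq> span (b ` {i. \<mu> i = \<kappa>})"
    proof clarify
      fix v assume v: "v \<in> span (range b)" "A v = \<kappa> *\<^sub>R v"
      from v(1) obtain c where "v = (\<Sum>x\<in>range b. c x *\<^sub>R x)"
        by (auto simp: span_finite)
      then have c: "v = (\<Sum>i\<in>UNIV. c (b i) *\<^sub>R b i)"
        using b(1) by (simp add: sum.reindex)
      have "(\<Sum>i\<in>UNIV. (c (b i) * (\<mu> i - \<kappa>)) *\<^sub>R b i) = A v - \<kappa> *\<^sub>R v"
        unfolding c
        by (simp add: A.sum A.scale eig scaleR_sum_right sum_subtractf[symmetric] algebra_simps)
      then have "c (b i) * (\<mu> i - \<kappa>) = 0" for i
        using independent_range_coeffs_zero[OF b, of "\<lambda>i. c (b i) * (\<mu> i - \<kappa>)"] v(2) by simp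
      then have z: "c (b i) = 0" if "\<mu> i \<noteq> \<kappa>" for i
        using that by (metis eq_iff_diff_eq_0 mult_eq_0_iff)
      have "v = (\<Sum>i\<in>{i. \<mu> i = \<kappa>}. c (b i) *\<^sub>R b i)"
        unfolding c by (rule sum.mono_neutral_right) (auto simp: z)
      also have "\<dots> \<in> span (b ` {i. \<mu> i = \<kappa>})"
        by (intro span_sum span_scale span_base) auto
      finally show "v \<in> span (b ` {i. \<mu> i = \<kappa>})" .
    qed
    have "subspace {v \<in> span (range b). A v = \<kappa> *\<^sub>R v}"
      by (auto simp: subspace_def span_add span_zero span_scale A.add A.scale A.zero scaleR_add_right)
    then show "span (b ` {i. \<mu> i = \<kappa>}) \<subseteq> {v \<in> span (range b). A v = \<kappa> *\<^sub>R v}"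
      by (intro span_minimal) (auto simp: span_base eig)
  qed
  moreover have "independent (b ` {i. \<mu> i = \<kappa>})"
    using b(2) by (rule independent_mono) auto
  moreover have "card (b ` {i. \<mu> i = \<kappa>}) = card {i. \<mu> i = \<kappa>}"
    using b(1) by (intro card_image) (auto simp: inj_on_def)
  ultimately show ?thesis by (simp add: dim_eq_card_independent)
qed

text \<open>
  Both products can be grouped by the values of the families. The principal curvatures are a choice
  among all families with prescribed multiplicities, and this makes the choice immaterial for their
  symmetric functions.
\<close>

lemma prod_eq_if_multiplicities_eq:
  fixes \<mu> \<nu> :: "'i::finite \<Rightarrow> 'b" and g :: "'b \<Rightarrow> 'c::comm_monoid_mult"
  assumes "\<And>\<kappa>. card {i. \<mu> i = \<kappa>} = card {i. \<nu> i = \<kappa>}"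
  shows "(\<Prod>i\<in>UNIV. g (\<mu> i)) = (\<Prod>i\<in>UNIV. g (\<nu> i))"
proof -
  have *: "(\<Prod>i\<in>UNIV. g (\<rho> i)) = (\<Prod>\<kappa>\<in>range \<rho>. g \<kappa> ^ card {i. \<rho> i = \<kappa>})" for \<rho> :: "'i \<Rightarrow> 'b"
    by (subst prod.image_gen[of UNIV _ \<rho>]) (auto intro!: prod.cong simp: prod_constant)
  have "\<kappa> \<in> range \<rho> \<longleftrightarrow> card {i. \<rho> i = \<kappa>} \<noteq> 0" for \<kappa> and \<rho> :: "'i \<Rightarrow> 'b"
    by (auto simp: card_eq_0_iff)
  then have "range \<mu> = range \<nu>"
    using assms by (metis subset_antisym subsetI)
  then show ?thesis by (simp add: * assms)
qed

section \<open>The determinant of a rank-one perturbation of a diagonal matrix\<close>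

text \<open>
  A permutation other than the identity moves at least two indices, hence one other than \<open>k\<close>, and
  picks a zero of the diagonal matrix there.
\<close>

lemma det_diagonal_one_row_replaced:
  fixes d :: "'n::finite \<Rightarrow> 'a::field" and v :: "'a^'n"
  shows "det (\<chi> i. if i = k then v else d i *s axis i 1) = v $ k * (\<Prod>j\<in>UNIV - {k}. d j)"
proof -
  let ?A = "\<chi> i. if i = k then v else d i *s axis i 1"
  let ?P = "{p. p permutes (UNIV :: 'n set)}"
  have "(\<Prod>i\<in>UNIV. ?A $ i $ p i) = 0" if p: "p permutes UNIV" "p \<noteq> id" for p
  proof -
    have "\<exists>i. i \<noteq> k \<and> p i \<noteq> i"
    proof (rule ccontr)
      assume "\<not> (\<exists>i. i \<noteq> k \<and> p i \<noteq> i)"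
      then have "p i = i" if "i \<noteq> k" for i using that by blast
      moreover from this have "p k = k"
        using p(1) by (metis permutes_univ)
      ultimately have "p = id" by (metis eq_id_iff)
      with p(2) show False by blast
    qed
    then obtain i where "i \<noteq> k" "p i \<noteq> i" by blast
    then have "?A $ i $ p i = 0" by (simp add: axis_def)
    then show ?thesis by (meson UNIV_I finite prod_zero)
  qed
  then have "det ?A = (\<Sum>p\<in>{id}. of_int (sign p) * (\<Prod>i\<in>UNIV. ?A $ i $ p i))"
    unfolding det_def
    by (intro sum.mono_neutral_right) (auto simp: permutes_id finite_permutations)
  also have "\<dots> = (\<Prod>i\<in>UNIV. ?A $ i $ i)" by simp
  also have "\<dots> = v $ k * (\<Prod>j\<in>UNIV - {k}. ?A $ j $ j)"
    by (subst prod.remove[of UNIV k]) auto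
  also have "(\<Prod>j\<in>UNIV - {k}. ?A $ j $ j) = (\<Prod>j\<in>UNIV - {k}. d j)"
    by (intro prod.cong) (auto simp: axis_def)
  finally show ?thesis .
qed

text \<open>
  The multiples of \<open>v\<close> in the other rows can be cleared with row \<open>k\<close>.
\<close>

lemma det_diagonal_row_multiples_added:
  fixes d u :: "'n::finite \<Rightarrow> 'a::field" and v :: "'a^'n"
  assumes "finite K" "k \<notin> K"
  shows "det (\<chi> i. if i = k then v else d i *s axis i 1 + (if i \<in> K then u i *s v else 0))
    = v $ k * (\<Prod>j\<in>UNIV - {k}. d j)"
  using assms
proof (induction K rule: finite_induct)
  case empty
  then show ?case by (simp add: det_diagonal_one_row_replaced cong: if_cong)
next
  case (insert m K)
  let ?A = "\<chi> i. if i = k then v else d i *s axis i 1 + (if i \<in> K then u i *s v else 0)"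
  have mk: "m \<noteq> k" using insert by auto
  have "(\<chi> i. if i = k then v else d i *s axis i 1 + (if i \<in> insert m K then u i *s v else 0))
      = (\<chi> i. if i = m then row m ?A + u m *s row k ?A else row i ?A)"
    using mk insert.hyps by (auto simp: vec_eq_iff row_def)
  then have "det (\<chi> i. if i = k then v else d i *s axis i 1 + (if i \<in> insert m K then u i *s v else 0))
      = det ?A"
    using det_row_operation[OF mk, of ?A "u m"] by simp
  then show ?case using insert by simp
qed

text \<open>
  Add the rank-one part one row at a time: by multilinearity each row contributes the determinant
  with that row replaced by a multiple of \<open>v\<close>. Unlike the formula via the inverse of the diagonal
  part, this allows zeros on the diagonal.
\<close>

lemma det_diagonal_plus_rank_one:
  fixes d u :: "'n::finite \<Rightarrow> 'a::field" and v :: "'a^'n"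
  shows "det (\<chi> i. d i *s axis i 1 + u i *s v)
    = (\<Prod>j\<in>UNIV. d j) + (\<Sum>k\<in>UNIV. u k * v $ k * (\<Prod>j\<in>UNIV - {k}. d j))"
proof -
  have "det (\<chi> i. d i *s axis i 1 + (if i \<in> K then u i *s v else 0))
    = (\<Prod>j\<in>UNIV. d j) + (\<Sum>k\<in>K. u k * v $ k * (\<Prod>j\<in>UNIV - {k}. d j))" if "finite K" for K
    using that
  proof (induction K rule: finite_induct)
    case empty
    have "det ((\<chi> i. d i *s axis i 1) :: 'a^'n^'n)
        = (\<Prod>i\<in>UNIV. ((\<chi> i. d i *s axis i 1) :: 'a^'n^'n) $ i $ i)"
      by (rule det_diagonal) (auto simp: axis_def)
    then show ?case by (simp add: axis_def)
  next
    case (insert k K)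
    let ?b = "\<lambda>i. d i *s axis i 1 :: 'a^'n"
    let ?c = "\<lambda>i. ?b i + (if i \<in> K then u i *s v else 0)"
    have "det (\<chi> i. ?b i + (if i \<in> insert k K then u i *s v else 0))
        = det (\<chi> i. if i = k then ?b i + u i *s v else ?c i)"
      by (rule arg_cong[of _ _ det]) (auto simp: vec_eq_iff)
    also have "\<dots> = det (\<chi> i. if i = k then ?b i else ?c i) + det (\<chi> i. if i = k then u i *s v else ?c i)"
      by (rule det_row_add)
    also have "(\<chi> i. if i = k then ?b i else ?c i) = (\<chi> i. ?c i)"
      using insert.hyps by (auto simp: vec_eq_iff)
    also have "det (\<chi> i. if i = k then u i *s v else ?c i) = det (\<chi> i. if i = k then u k *s v else ?c i)"
      by (rule arg_cong[of _ _ det]) (auto simp: vec_eq_iff)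
    also have "\<dots> = u k * det (\<chi> i. if i = k then v else ?c i)"
      by (rule det_row_mul)
    also have "det (\<chi> i. if i = k then v else ?c i) = v $ k * (\<Prod>j\<in>UNIV - {k}. d j)"
      by (rule det_diagonal_row_multiples_added) (use insert.hyps in auto)
    finally show ?case
      using insert by (simp add: algebra_simps)
  qed
  from this[of UNIV] show ?thesis by simp
qed

text \<open>
  In the basis of eigenvectors the matrix is diagonal; the change of basis cancels in the determinant.
\<close>

lemma det_eigenbasis:
  fixes L :: "real ^ 'n \<Rightarrow> real ^ 'n" and w :: "'n \<Rightarrow> real ^ 'n"
  assumes L: "linear L"
    and indep: "\<And>c. (\<Sum>i\<in>UNIV. c i *\<^sub>R w i) = 0 \<Longrightarrow> \<forall>i. c i = 0"
    and eig: "\<And>i. L (w i) = \<mu> i *\<^sub>R w i"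
  shows "det (matrix L) = (\<Prod>i\<in>UNIV. \<mu> i)"
proof -
  define P :: "real^'n^'n" where "P = (\<chi> i j. w j $ i)"
  define D :: "real^'n^'n" where "D = (\<chi> i j. if i = j then \<mu> i else 0)"
  have column: "column j P = w j" for j
    by (simp add: P_def column_def vec_eq_iff)
  have "\<exists>B. B ** P = mat 1"
    unfolding matrix_left_invertible_independent_columns column
    using indep by (simp add: scalar_mult_eq_scaleR)
  then have "det P \<noteq> 0"
    using invertible_det_nz invertible_left_inverse by blast
  have "(matrix L ** P) $ i $ j = (P ** D) $ i $ j" for i j
  proof -
    have "(matrix L ** P) $ i $ j = (matrix L *v w j) $ i"
      by (simp add: matrix_matrix_mult_def matrix_vector_mult_def P_def)
    also have "\<dots> = (\<mu> j *\<^sub>R w j) $ i"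
      using matrix_works L linear_matrix_vector_mul_eq eig by metis
    also have "\<dots> = (P ** D) $ i $ j"
      by (simp add: matrix_matrix_mult_def P_def D_def if_distrib cong: if_cong)
    finally show ?thesis .
  qed
  then have "matrix L ** P = P ** D" by (simp add: vec_eq_iff)
  then have "det (matrix L) * det P = det P * det D"
    by (metis det_mul)
  moreover have "det D = (\<Prod>i\<in>UNIV. D $ i $ i)"
    by (rule det_diagonal) (simp add: D_def)
  ultimately show ?thesis
    using \<open>det P \<noteq> 0\<close> by (simp add: D_def)
qed

section \<open>Elementary symmetric functions\<close>

text \<open>
  Comparison of the coefficients of \<open>s ^ r\<close>.
\<close>

lemma sum_subsets_eq_if_generating_functions_eq:
  fixes a b :: "'n::finite set \<Rightarrow> real"
  assumes "\<And>s. (\<Sum>J\<in>UNIV. s ^ card J * a J) = (\<Sum>J\<in>UNIV. s ^ card J * b J)"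
  shows "(\<Sum>J | card J = r. a J) = (\<Sum>J | card J = r. b J)"
proof -
  have *: "(\<Sum>J\<in>UNIV. s ^ card J * c J) = (\<Sum>k\<le>CARD('n). (\<Sum>J | card J = k. c J) * s ^ k)"
    for s and c :: "'n set \<Rightarrow> real"
  proof -
    have "(\<Sum>J\<in>UNIV. s ^ card J * c J)
        = (\<Sum>k\<le>CARD('n). \<Sum>J\<in>{J\<in>UNIV. card J = k}. s ^ card J * c J)"
      by (rule sum.group[symmetric]) (auto simp: card_mono)
    then show ?thesis by (simp add: sum_distrib_left mult.commute)
  qed
  show ?thesis
  proof (cases "r \<le> CARD('n)")
    case True
    have "\<forall>k\<le>CARD('n). (\<Sum>J | card J = k. a J) = (\<Sum>J | card J = k. b J)"
      using assms polyfun_eq_coeffs[of "\<lambda>k. \<Sum>J | card J = k. a J" "CARD('n)" "\<lambda>k. \<Sum>J | card J = k. b J"]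
      unfolding * by blast
    with True show ?thesis by blast
  next
    case False
    then have "{J :: 'n set. card J = r} = {}"
      by (auto simp: card_mono)
    then show ?thesis by simp
  qed
qed

lemma prod_one_plus:
  fixes a :: "'n::finite \<Rightarrow> real"
  shows "(\<Prod>i\<in>UNIV. 1 + s * a i) = (\<Sum>J\<in>UNIV. s ^ card J * (\<Prod>i\<in>J. a i))"
proof -
  have "(\<Prod>i\<in>UNIV. s * a i + 1) = (\<Sum>J\<in>Pow UNIV. (\<Prod>i\<in>J. s * a i) * (\<Prod>i\<in>UNIV - J. 1))"
    by (rule prod_add) simp
  then show ?thesis by (simp add: prod.distrib add.commute)
qed

text \<open>
  The determinant of the identity plus \<open>s\<close> times the shape operator has the form of the left-hand
  side. To expand it, read \<open>s * a k * (\<Prod>j\<in>UNIV - {k}. 1 + s * a j)\<close> as the product over all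
  \<open>j\<close> of \<open>1 + s * a j\<close> in which the summand \<open>1\<close> is dropped for \<open>j = k\<close>; its expansion runs
  over the sets \<open>J\<close> that contain \<open>k\<close>.
\<close>

lemma prod_one_plus_minus_derivative:
  fixes a y :: "'n::finite \<Rightarrow> real"
  shows "(\<Prod>j\<in>UNIV. 1 + s * a j) - (\<Sum>k\<in>UNIV. s * a k * y k * (\<Prod>j\<in>UNIV - {k}. 1 + s * a j))
    = (\<Sum>J\<in>UNIV. s ^ card J * ((\<Prod>i\<in>J. a i) * (1 - (\<Sum>k\<in>J. y k))))"
proof -
  have *: "s * a k * (\<Prod>j\<in>UNIV - {k}. 1 + s * a j)
      = (\<Sum>J\<in>UNIV. s ^ card J * (\<Prod>i\<in>J. a i) * (if k \<in> J then 1 else 0))" for k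
  proof -
    have "(\<Prod>j\<in>UNIV - {k}. s * a j + (if j = k then 0 else 1)) = (\<Prod>j\<in>UNIV - {k}. 1 + s * a j)"
      by (intro prod.cong) auto
    then have "s * a k * (\<Prod>j\<in>UNIV - {k}. 1 + s * a j)
        = (\<Prod>j\<in>UNIV. s * a j + (if j = k then 0 else 1))"
      using prod.remove[of UNIV k "\<lambda>j. s * a j + (if j = k then 0 else 1)"] by simp
    also have "\<dots> = (\<Sum>J\<in>UNIV. (\<Prod>j\<in>J. s * a j) * (\<Prod>j\<in>UNIV - J. if j = k then 0 else 1))"
      by (subst prod_add) auto
    also have "\<dots> = (\<Sum>J\<in>UNIV. s ^ card J * (\<Prod>i\<in>J. a i) * (if k \<in> J then 1 else 0))"
      by (intro sum.cong refl) (auto simp: prod.distrib prod_zero_iff)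
    finally show ?thesis .
  qed
  have "(\<Sum>k\<in>UNIV. s * a k * y k * (\<Prod>j\<in>UNIV - {k}. 1 + s * a j))
      = (\<Sum>k\<in>UNIV. y k * (\<Sum>J\<in>UNIV. s ^ card J * (\<Prod>i\<in>J. a i) * (if k \<in> J then 1 else 0)))"
    by (intro sum.cong refl, subst *[symmetric]) (simp add: mult_ac)
  also have "\<dots> = (\<Sum>J\<in>UNIV. \<Sum>k\<in>UNIV. s ^ card J * (\<Prod>i\<in>J. a i) * (if k \<in> J then y k else 0))"
    unfolding sum_distrib_left by (subst sum.swap) (auto intro!: sum.cong)
  also have "\<dots> = (\<Sum>J\<in>UNIV. s ^ card J * (\<Prod>i\<in>J. a i) * (\<Sum>k\<in>J. y k))"
    unfolding sum_distrib_left[symmetric] by (simp add: sum.If_cases)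
  finally show ?thesis
    unfolding prod_one_plus by (simp add: sum_subtractf[symmetric] algebra_simps)
qed

section \<open>Linear independence of shifted powers\<close>

text \<open>
  Each differentiation in \<open>t\<close> lowers the exponent and brings out a factor \<open>q - k\<close>, which stays
  nonzero in the range of \<open>k\<close> that is allowed.
\<close>

lemma shifted_powers_derivatives_vanish:
  fixes l b :: "'i \<Rightarrow> real"
  assumes b: "\<And>i. i \<in> I \<Longrightarrow> b i > 0" and \<alpha>: "0 \<le> \<alpha>"
    and zero: "\<And>t. t \<in> {\<alpha><..<\<beta>} \<Longrightarrow> (\<Sum>i\<in>I. l i * (b i + t) powr q) = 0"
    and k: "real k < q + 1"
    and t: "t \<in> {\<alpha><..<\<beta>}"
  shows "(\<Sum>i\<in>I. l i * (b i + t) powr (q - real k)) = 0"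
  using k t
proof (induction k arbitrary: t)
  case 0
  then show ?case using zero by simp
next
  case (Suc k)
  have "((\<lambda>t. \<Sum>i\<in>I. l i * (b i + t) powr (q - real k)) has_real_derivative
      (\<Sum>i\<in>I. l i * ((q - real k) * (b i + t) powr (q - real k - 1)))) (at t)"
    using b Suc.prems(2) \<alpha> by (auto intro!: derivative_eq_intros sum.cong simp: add_pos_pos)
  moreover have "((\<lambda>t. \<Sum>i\<in>I. l i * (b i + t) powr (q - real k)) has_real_derivative 0) (at t)"
  proof (rule has_field_derivative_transform_within_open[where S = "{\<alpha><..<\<beta>}"])
    show "((\<lambda>_. 0) has_real_derivative 0) (at t)" by simp
  qed (use Suc in auto)
  ultimately have "(\<Sum>i\<in>I. l i * ((q - real k) * (b i + t) powr (q - real k - 1))) = 0"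
    by (rule DERIV_unique)
  then have "(q - real k) * (\<Sum>i\<in>I. l i * (b i + t) powr (q - real (Suc k))) = 0"
    by (simp add: sum_distrib_left mult.left_commute diff_diff_eq add.commute)
  moreover have "q - real k \<noteq> 0" using Suc.prems(1) by simp
  ultimately show ?case by simp
qed

text \<open>
  This is the invertibility of the Vandermonde matrix with nodes \<open>z i\<close>: the vanishing moments kill
  every polynomial of degree less than \<open>card I\<close>, in particular the one that vanishes at all
  nodes except \<open>z j\<close>.
\<close>

lemma moments_zero_imp_weights_zero:
  fixes w z :: "'i \<Rightarrow> 'a::field"
  assumes I: "finite I" and z: "inj_on z I"
    and moments: "\<And>k. k < card I \<Longrightarrow> (\<Sum>i\<in>I. w i * z i ^ k) = 0"
    and j: "j \<in> I"
  shows "w j = 0"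
proof -
  define p where "p = (\<Prod>i\<in>I - {j}. [:- z i, 1:])"
  have "degree p \<le> card (I - {j})"
    unfolding p_def using degree_prod_sum_le[of "I - {j}" "\<lambda>i. [:- z i, 1:]"] I by simp
  then have deg: "degree p < card I"
    using I j by (metis card_Diff1_less le_less_trans)
  have "(\<Sum>i\<in>I. w i * poly p (z i)) = (\<Sum>i\<in>I. \<Sum>k\<le>degree p. coeff p k * (w i * z i ^ k))"
    by (simp add: poly_altdef sum_distrib_left mult_ac)
  also have "\<dots> = (\<Sum>k\<le>degree p. coeff p k * (\<Sum>i\<in>I. w i * z i ^ k))"
    by (subst sum.swap) (simp add: sum_distrib_left)
  also have "\<dots> = 0"
    using deg moments by (intro sum.neutral) auto
  finally have "(\<Sum>i\<in>I. w i * poly p (z i)) = 0" .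
  moreover have "poly p (z i) = 0" if "i \<in> I" "i \<noteq> j" for i
    using that I by (auto simp: p_def poly_prod prod_zero_iff)
  then have "(\<Sum>i\<in>I. w i * poly p (z i)) = w j * poly p (z j)"
    using I j by (subst sum.remove[of I j]) auto
  moreover have "poly p (z j) \<noteq> 0"
    using I z j by (auto simp: p_def poly_prod prod_zero_iff inj_on_def)
  ultimately show ?thesis by simp
qed

text \<open>
  Dividing the derivatives of the relation at one point \<open>t\<close> by \<open>(b i + t) powr q\<close> termwise turns
  them into moments of the distinct nodes \<open>1 / (b i + t)\<close>. The bound on \<open>card I\<close> ensures that none
  of the derivatives that are used is trivial.
\<close>

lemma shifted_powers_linearly_independent:
  fixes l b :: "'i \<Rightarrow> real"
  assumes I: "finite I" and b: "inj_on b I" "\<And>i. i \<in> I \<Longrightarrow> b i > 0"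
    and \<alpha>: "0 \<le> \<alpha>" "\<alpha> < \<beta>" and q: "real (card I) < q + 2"
    and zero: "\<And>t. t \<in> {\<alpha><..<\<beta>} \<Longrightarrow> (\<Sum>i\<in>I. l i * (b i + t) powr q) = 0"
    and j: "j \<in> I"
  shows "l j = 0"
proof -
  define t where "t = (\<alpha> + \<beta>) / 2"
  have t: "t \<in> {\<alpha><..<\<beta>}" "t > 0" using \<alpha> by (auto simp: t_def)
  have pos: "b i + t > 0" if "i \<in> I" for i using b(2)[OF that] t by simp
  have "l j * (b j + t) powr q = 0"
  proof (rule moments_zero_imp_weights_zero[OF I, where z = "\<lambda>i. inverse (b i + t)"
        and w = "\<lambda>i. l i * (b i + t) powr q"])
    show "inj_on (\<lambda>i. inverse (b i + t)) I"
      using b(1) by (auto simp: inj_on_def)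
    fix k assume k: "k < card I"
    then have "real k + 1 \<le> real (card I)" by linarith
    then have "real k < q + 1" using q by linarith
    from shifted_powers_derivatives_vanish[OF b(2) \<alpha>(1) zero this t(1)]
    have "(\<Sum>i\<in>I. l i * (b i + t) powr (q - real k)) = 0" by simp
    moreover have "(b i + t) powr (q - real k) = (b i + t) powr q * inverse (b i + t) ^ k"
      if "i \<in> I" for i
      using pos[OF that] by (simp add: powr_diff powr_realpow divide_inverse power_inverse)
    ultimately show "(\<Sum>i\<in>I. l i * (b i + t) powr q * inverse (b i + t) ^ k) = 0"
      by (simp add: mult.assoc)
  qed (use j in auto)
  then show ?thesis using pos[OF j] by simp
qed

section \<open>The equation along two coordinates\<close>

lemma four_vectors_in_dimension_three_dependent:
  fixes v :: "4 \<Rightarrow> real ^ 3"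
  shows "\<exists>l :: 4 \<Rightarrow> real. (\<exists>k. l k \<noteq> 0) \<and> (\<forall>m. (\<Sum>k\<in>UNIV. l k * v k $ m) = 0)"
proof -
  define A :: "real^4^3" where "A = (\<chi> m k. v k $ m)"
  have "rank A \<noteq> CARD(4)"
    using rank_bound[of A] by simp
  then obtain x where x: "x \<noteq> 0" "A *v x = 0"
    using matrix_nonfull_linear_equations_eq[of A] by blast
  show ?thesis
  proof (intro exI[of _ "\<lambda>k. x $ k"] conjI allI)
    show "\<exists>k. x $ k \<noteq> 0" using x(1) by (auto simp: vec_eq_iff)
    fix m
    have "(A *v x) $ m = 0" using x(2) by simp
    then show "(\<Sum>k\<in>UNIV. x $ k * v k $ m) = 0"
      by (simp add: matrix_vector_mult_def A_def mult.commute)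
  qed
qed

text \<open>
  Four values of \<open>u\<close> give linearly dependent vectors \<open>(P u, Q u, E u)\<close>; the same combination of
  the right-hand sides is a linear relation between four shifted powers.
\<close>

lemma separated_equation_constant_zero:
  fixes h \<tau> :: "'s \<Rightarrow> real" and P Q E b :: "'u \<Rightarrow> real"
  assumes eq: "\<And>s u. s \<in> S \<Longrightarrow> u \<in> U \<Longrightarrow> h s * P u + Q u + \<tau> s * E u = c * (b u + \<tau> s) powr q"
    and b: "\<And>u. u \<in> U \<Longrightarrow> b u > 0"
    and S: "0 \<le> \<alpha>" "\<alpha> < \<beta>" "{\<alpha>..\<beta>} \<subseteq> \<tau> ` S"
    and U: "infinite (b ` U)"
    and q: "2 < q"
  shows "c = 0"
proof (rule ccontr)
  assume c: "c \<noteq> 0"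
  obtain B where B: "B \<subseteq> b ` U" "finite B" "card B = 4"
    using infinite_arbitrarily_large[OF U, of 4] by blast
  then obtain y :: "4 \<Rightarrow> real" where y: "bij_betw y UNIV B"
    using finite_same_card_bij[of "UNIV :: 4 set" B] by auto
  have "y k \<in> b ` U" for k
    using bij_betwE[OF y] B(1) by auto
  then have "\<forall>k. \<exists>v. v \<in> U \<and> b v = y k" by (metis imageE)
  then obtain u where u: "\<And>k. u k \<in> U" "\<And>k. b (u k) = y k" by metis
  obtain l where l: "\<exists>k. l k \<noteq> 0"
      "\<And>m. (\<Sum>k\<in>UNIV. l k * (vector [P (u k), Q (u k), E (u k)] :: real^3) $ m) = 0"
    using four_vectors_in_dimension_three_dependent
      [where v = "\<lambda>k. vector [P (u k), Q (u k), E (u k)]"] by (elim exE conjE) blast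
  have lP: "(\<Sum>k\<in>UNIV. l k * P (u k)) = 0" and lQ: "(\<Sum>k\<in>UNIV. l k * Q (u k)) = 0"
    and lE: "(\<Sum>k\<in>UNIV. l k * E (u k)) = 0"
    using l(2)[of 1] l(2)[of 2] l(2)[of 3] by simp_all
  have "(\<Sum>k\<in>UNIV. l k * (b (u k) + t) powr q) = 0" if t: "t \<in> {\<alpha><..<\<beta>}" for t
  proof -
    have "t \<in> \<tau> ` S" using t S(3) by (meson greaterThanLessThan_subseteq_atLeastAtMost_iff subsetD order_refl)
    then obtain s where s: "s \<in> S" "t = \<tau> s" by blast
    have "c * (\<Sum>k\<in>UNIV. l k * (b (u k) + t) powr q)
        = (\<Sum>k\<in>UNIV. l k * (h s * P (u k) + Q (u k) + \<tau> s * E (u k)))"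
      by (simp add: eq[OF s(1) u(1)] s(2) sum_distrib_left mult.left_commute)
    also have "\<dots> = h s * (\<Sum>k\<in>UNIV. l k * P (u k)) + (\<Sum>k\<in>UNIV. l k * Q (u k))
        + \<tau> s * (\<Sum>k\<in>UNIV. l k * E (u k))"
      by (simp add: sum_distrib_left sum.distrib algebra_simps)
    finally show ?thesis using lP lQ lE c by simp
  qed
  moreover have "inj (\<lambda>k. b (u k))"
    using y u(2) by (simp add: bij_betw_def)
  ultimately have "l k = 0" for k
    using shifted_powers_linearly_independent[of UNIV "\<lambda>k. b (u k)" \<alpha> \<beta> q l k] b u(1) S(1,2) q
    by simp
  with l(1) show False by blast
qed

text \<open>
  The image is connected, so it suffices that the square is not constant near \<open>p\<close>. If it
  were, its derivative \<open>2 * g p * d\<close> would vanish, hence \<open>g\<close> itself would vanish near \<open>p\<close>.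
\<close>

lemma square_image_contains_interval:
  fixes g :: "real \<Rightarrow> real"
  assumes cont: "continuous_on (ball p \<delta>) g" and \<delta>: "\<delta> > 0"
    and der: "(g has_real_derivative d) (at p)" "d \<noteq> 0"
  obtains \<alpha> \<beta> where "0 \<le> \<alpha>" "\<alpha> < \<beta>" "{\<alpha>..\<beta>} \<subseteq> (\<lambda>x. (g x)\<^sup>2) ` ball p \<delta>"
proof -
  have "\<exists>x\<in>ball p \<delta>. (g x)\<^sup>2 \<noteq> (g p)\<^sup>2"
  proof (rule ccontr)
    assume "\<not> (\<exists>x\<in>ball p \<delta>. (g x)\<^sup>2 \<noteq> (g p)\<^sup>2)"
    then have const: "(g x)\<^sup>2 = (g p)\<^sup>2" if "x \<in> ball p \<delta>" for x using that by blast
    have "((\<lambda>x. (g x)\<^sup>2) has_real_derivative 2 * g p * d) (at p)"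
      by (auto intro!: derivative_eq_intros der)
    moreover have "((\<lambda>x. (g x)\<^sup>2) has_real_derivative 0) (at p)"
    proof (rule has_field_derivative_transform_within_open[OF DERIV_const open_ball])
      show "p \<in> ball p \<delta>" using \<delta> by simp
      show "(g p)\<^sup>2 = (g x)\<^sup>2" if "x \<in> ball p \<delta>" for x
        using const[OF that] by (rule sym)
    qed
    ultimately have "2 * g p * d = 0" by (rule DERIV_unique)
    then have "g p = 0" using der(2) by simp
    have zero: "g x = 0" if "x \<in> ball p \<delta>" for x
      using const[OF that] \<open>g p = 0\<close> by simp
    have "(g has_real_derivative 0) (at p)"
      by (rule has_field_derivative_transform_within_open[where f = "\<lambda>_. 0" and S = "ball p \<delta>"])
        (use zero \<delta> in auto)
    with der show False by (metis DERIV_unique)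
  qed
  then obtain x where x: "x \<in> ball p \<delta>" "(g x)\<^sup>2 \<noteq> (g p)\<^sup>2" by blast
  have conn: "connected ((\<lambda>x. (g x)\<^sup>2) ` ball p \<delta>)"
    by (intro connected_continuous_image continuous_intros cont connected_ball)
  show thesis
  proof
    show "0 \<le> min ((g x)\<^sup>2) ((g p)\<^sup>2)" by simp
    show "min ((g x)\<^sup>2) ((g p)\<^sup>2) < max ((g x)\<^sup>2) ((g p)\<^sup>2)" using x(2) by auto
    show "{min ((g x)\<^sup>2) ((g p)\<^sup>2)..max ((g x)\<^sup>2) ((g p)\<^sup>2)} \<subseteq> (\<lambda>x. (g x)\<^sup>2) ` ball p \<delta>"
      by (rule connected_contains_Icc[OF conn]) (use x(1) \<delta> in \<open>auto simp: min_def max_def\<close>)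
  qed
qed

text \<open>
  For \<open>g\<close> and \<open>h\<close> the slopes and second derivatives of the summands, this is the \<open>r\<close>-th symmetric
  function of the principal curvatures of the graph without its power of the area density.
\<close>

definition curvature_form :: "nat \<Rightarrow> ('n::finite \<Rightarrow> real) \<Rightarrow> ('n \<Rightarrow> real) \<Rightarrow> real" where
  "curvature_form r h g = (\<Sum>J | card J = r. (\<Prod>i\<in>J. h i) * (1 + (\<Sum>m\<in>-J. (g m)\<^sup>2)))"

text \<open>
  Each index set \<open>J\<close> sees the \<open>i\<close>-th variables either through \<open>h i\<close> (if \<open>i \<in> J\<close>) or through
  \<open>(g i)\<^sup>2\<close> (if \<open>i \<notin> J\<close>), but never through a product of both.
\<close>

lemma curvature_form_one_variable:
  fixes h g :: "'n::finite \<Rightarrow> real"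
  shows "\<exists>P Q E. \<forall>x y. curvature_form r (h(i := x)) (g(i := y)) = x * P + Q + y\<^sup>2 * E"
proof -
  define p where "p J = (if i \<in> J then (\<Prod>k\<in>J - {i}. h k) * (1 + (\<Sum>m\<in>-J. (g m)\<^sup>2)) else 0)" for J
  define q where "q J = (if i \<in> J then 0 else (\<Prod>k\<in>J. h k) * (1 + (\<Sum>m\<in>-J - {i}. (g m)\<^sup>2)))" for J
  define e where "e J = (if i \<in> J then 0 else \<Prod>k\<in>J. h k)" for J
  have "(\<Prod>k\<in>J. (h(i := x)) k) * (1 + (\<Sum>m\<in>-J. ((g(i := y)) m)\<^sup>2)) = x * p J + q J + y\<^sup>2 * e J"
    for J x y
  proof (cases "i \<in> J")
    case True
    have "(\<Prod>k\<in>J. (h(i := x)) k) = x * (\<Prod>k\<in>J - {i}. h k)"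
      using True by (subst prod.remove[of J i]) (auto intro!: prod.cong)
    moreover have "(\<Sum>m\<in>-J. ((g(i := y)) m)\<^sup>2) = (\<Sum>m\<in>-J. (g m)\<^sup>2)"
      using True by (intro sum.cong) auto
    ultimately show ?thesis using True by (simp add: p_def q_def e_def)
  next
    case False
    have "(\<Prod>k\<in>J. (h(i := x)) k) = (\<Prod>k\<in>J. h k)"
      using False by (intro prod.cong) auto
    moreover have "(\<Sum>m\<in>-J. ((g(i := y)) m)\<^sup>2) = y\<^sup>2 + (\<Sum>m\<in>-J - {i}. (g m)\<^sup>2)"
      using False by (subst sum.remove[of "-J" i]) (auto intro!: sum.cong)
    ultimately show ?thesis using False by (simp add: p_def q_def e_def algebra_simps)
  qed
  then have "curvature_form r (h(i := x)) (g(i := y))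
      = x * (\<Sum>J | card J = r. p J) + (\<Sum>J | card J = r. q J) + y\<^sup>2 * (\<Sum>J | card J = r. e J)" for x y
    by (simp add: curvature_form_def sum.distrib sum_distrib_left)
  then show ?thesis by blast
qed

section \<open>Graphs of separated sums\<close>

locale translation_graph =
  fixes U :: "(real ^ 'n) set" and f :: "'n \<Rightarrow> real \<Rightarrow> real"
  assumes open_U: "open U"
    and smooth: "\<And>i. smooth_real_on (f i) ((\<lambda>x. x $ i) ` U)"
begin

definition height :: "real ^ 'n \<Rightarrow> real" where
  "height x = (\<Sum>i\<in>UNIV. f i (x $ i))"

definition lift :: "real ^ 'n \<Rightarrow> (real ^ 'n) \<times> real" where
  "lift x = (x, height x)"

definition slope :: "real ^ 'n \<Rightarrow> real ^ 'n" where
  "slope x = (\<chi> i. deriv (f i) (x $ i))"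

text \<open>
  The diagonal of the Hessian of the height function; as vectors multiply componentwise, the Hessian
  maps \<open>w\<close> to \<open>hess x * w\<close>.
\<close>

definition hess :: "real ^ 'n \<Rightarrow> real ^ 'n" where
  "hess x = (\<chi> i. deriv (deriv (f i)) (x $ i))"

definition area :: "real ^ 'n \<Rightarrow> real" where
  "area x = sqrt (1 + slope x \<bullet> slope x)"

definition normal :: "real ^ 'n \<Rightarrow> (real ^ 'n) \<times> real" where
  "normal x = (1 / area x) *\<^sub>R (- slope x, 1)"

definition tangent :: "real ^ 'n \<Rightarrow> real ^ 'n \<Rightarrow> (real ^ 'n) \<times> real" where
  "tangent x w = (w, slope x \<bullet> w)"

text \<open>
  The shape operator with respect to \<open>normal\<close>, transported to the parameter space by \<open>tangent x\<close>.
\<close>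

definition shape :: "real ^ 'n \<Rightarrow> real ^ 'n \<Rightarrow> real ^ 'n" where
  "shape x w = (1 / area x) *\<^sub>R (hess x * w - (slope x \<bullet> (hess x * w) / (area x)\<^sup>2) *\<^sub>R slope x)"

lemma area_pos: "area x > 0"
  by (simp add: area_def add_pos_nonneg)

lemma area_squared: "(area x)\<^sup>2 = 1 + slope x \<bullet> slope x"
  by (simp add: area_def)

lemma norm_normal: "norm (normal x) = 1"
proof -
  have "norm (- slope x, 1 :: real) = area x"
    by (simp add: norm_Pair area_def dot_square_norm add.commute)
  then show ?thesis
    unfolding normal_def norm_scaleR using area_pos[of x] by simp
qed

lemma slope_inner_shape: "slope x \<bullet> shape x w = slope x \<bullet> (hess x * w) / area x ^ 3"
proof -
  let ?d = "slope x \<bullet> (hess x * w)"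
  have "slope x \<bullet> slope x = (area x)\<^sup>2 - 1" by (simp add: area_squared)
  then have "slope x \<bullet> shape x w = (1 / area x) * (?d - ?d / (area x)\<^sup>2 * ((area x)\<^sup>2 - 1))"
    by (simp add: shape_def inner_diff_right)
  also have "\<dots> = ?d / area x ^ 3"
    using area_pos[of x] by (simp add: power2_eq_square power3_eq_cube field_simps)
  finally show ?thesis .
qed

lemma open_coordinate_image: "open ((\<lambda>x. x $ i) ` U)"
proof (rule openI)
  fix y assume "y \<in> (\<lambda>x. x $ i) ` U"
  then obtain x where x: "x \<in> U" "y = x $ i" by blast
  obtain e where e: "e > 0" "ball x e \<subseteq> U"
    using open_U x(1) by (meson open_contains_ball)
  have "z \<in> (\<lambda>x. x $ i) ` U" if "z \<in> ball y e" for z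
  proof
    show "x + (z - y) *\<^sub>R axis i 1 \<in> U"
      using e(2) that by (auto simp: dist_norm norm_axis_1 subset_iff norm_minus_commute)
    show "z = (x + (z - y) *\<^sub>R axis i 1) $ i"
      using x(2) by (simp add: axis_def)
  qed
  with e(1) show "\<exists>e>0. ball y e \<subseteq> (\<lambda>x. x $ i) ` U" by blast
qed

lemma iterated_deriv:
  assumes "x \<in> U"
  shows "((deriv ^^ k) (f i) has_real_derivative (deriv ^^ Suc k) (f i) (x $ i)) (at (x $ i))"
proof -
  have "(deriv ^^ k) (f i) differentiable_on ((\<lambda>x. x $ i) ` U)"
    using smooth by (simp add: smooth_real_on_def)
  then have "(deriv ^^ k) (f i) differentiable (at (x $ i))"
    using differentiable_on_eq_differentiable_at open_coordinate_image assms by blast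
  then show ?thesis
    by (simp add: DERIV_deriv_iff_real_differentiable)
qed

lemma deriv_f: "x \<in> U \<Longrightarrow> (f i has_real_derivative slope x $ i) (at (x $ i))"
  using iterated_deriv[of x 0 i] by (simp add: slope_def)

lemma deriv_slope: "x \<in> U \<Longrightarrow> (deriv (f i) has_real_derivative hess x $ i) (at (x $ i))"
  using iterated_deriv[of x 1 i] by (simp add: hess_def)

lemma has_derivative_coordinate:
  assumes "(g has_real_derivative d) (at (x $ i))"
  shows "((\<lambda>x. g (x $ i)) has_derivative (\<lambda>w. d * w $ i)) (at x)"
proof -
  have "((\<lambda>x. x $ i) has_derivative (\<lambda>w. w $ i)) (at x)"
    by (intro bounded_linear_imp_has_derivative bounded_linear_vec_nth)
  then show ?thesis
    using diff_chain_at[of "\<lambda>x. x $ i" _ x g "(*) d"] assms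
    by (simp add: has_field_derivative_def o_def)
qed

lemma has_derivative_height:
  assumes "x \<in> U"
  shows "(height has_derivative (\<lambda>w. slope x \<bullet> w)) (at x)"
proof -
  have "((\<lambda>x. \<Sum>i\<in>UNIV. f i (x $ i)) has_derivative (\<lambda>w. \<Sum>i\<in>UNIV. slope x $ i * w $ i)) (at x)"
    by (intro has_derivative_sum has_derivative_coordinate deriv_f assms)
  then show ?thesis by (simp add: height_def[abs_def] inner_vec_def)
qed

lemma has_derivative_lift:
  assumes "x \<in> U"
  shows "(lift has_derivative tangent x) (at x)"
  unfolding lift_def[abs_def] tangent_def[abs_def]
  by (intro has_derivative_Pair has_derivative_ident has_derivative_height assms)

lemma has_derivative_slope:
  assumes "x \<in> U"
  shows "(slope has_derivative (\<lambda>w. hess x * w)) (at x)"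
proof -
  have "((\<lambda>x. slope x \<bullet> axis i 1) has_derivative (\<lambda>w. (hess x * w) \<bullet> axis i 1)) (at x)" for i
    using has_derivative_coordinate[OF deriv_slope[OF assms, of i]]
    by (simp add: inner_axis slope_def)
  then show ?thesis
    by (subst has_derivative_componentwise_within) (auto simp: Basis_vec_def)
qed

text \<open>
  As a unit field, the normal can only vary tangentially, so its derivative is the image under
  \<open>tangent x\<close> of its horizontal part.
\<close>

lemma has_derivative_normal:
  assumes "x \<in> U"
  shows "(normal has_derivative (\<lambda>w. - tangent x (shape x w))) (at x)"
proof -
  let ?d = "\<lambda>w. slope x \<bullet> (hess x * w)"
  have pos: "1 + slope x \<bullet> slope x > 0" by (simp add: add_pos_nonneg)
  have area: "(area has_derivative (\<lambda>w. ?d w / area x)) (at x)"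
    unfolding area_def[abs_def] using pos
    by (auto intro!: derivative_eq_intros has_derivative_slope assms
        simp: fun_eq_iff inner_commute divide_simps)
  have inv: "((\<lambda>x. 1 / area x) has_derivative (\<lambda>w. - ?d w / (area x) ^ 3)) (at x)"
    using area_pos[of x]
    by (auto intro!: derivative_eq_intros area simp: fun_eq_iff power2_eq_square power3_eq_cube divide_simps)
  have "(normal has_derivative (\<lambda>w. (1 / area x) *\<^sub>R (- (hess x * w), 0)
      + (- ?d w / (area x) ^ 3) *\<^sub>R (- slope x, 1))) (at x)"
    unfolding normal_def[abs_def]
    by (intro has_derivative_scaleR inv has_derivative_Pair has_derivative_minus
        has_derivative_slope assms has_derivative_const)
  moreover have "(1 / area x) *\<^sub>R (- (hess x * w), 0) + (- ?d w / (area x) ^ 3) *\<^sub>R (- slope x, 1)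
      = - tangent x (shape x w)" for w
    using area_pos[of x]
    by (simp add: tangent_def slope_inner_shape)
      (simp add: shape_def scaleR_diff_right power2_eq_square power3_eq_cube)
  ultimately show ?thesis by simp
qed

lemma linear_tangent: "linear (tangent x)"
  by (intro linearI) (auto simp: tangent_def inner_add_right)

lemma inj_tangent: "inj (tangent x)"
  by (auto simp: inj_on_def tangent_def)

lemma linear_shape: "linear (shape x)"
  by (intro linearI) (auto simp: shape_def vec_eq_iff inner_vec_def algebra_simps
      sum.distrib sum_distrib_left add_divide_distrib diff_divide_distrib)

lemma curve_in_graph:
  assumes x: "x \<in> U"
  obtains T where "open T" "0 \<in> T" "(\<lambda>t. lift (x + t *\<^sub>R w)) ` T \<subseteq> lift ` U"
    "((\<lambda>t. lift (x + t *\<^sub>R w)) has_derivative (\<lambda>t. t *\<^sub>R tangent x w)) (at 0)"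
proof
  let ?l = "\<lambda>t. x + t *\<^sub>R w"
  show "open (?l -` U)"
    by (intro continuous_open_vimage open_U continuous_intros)
  show "0 \<in> ?l -` U" using x by simp
  show "(\<lambda>t. lift (x + t *\<^sub>R w)) ` (?l -` U) \<subseteq> lift ` U" by auto
  have "(?l has_derivative (\<lambda>t. t *\<^sub>R w)) (at 0)"
    by (auto intro!: derivative_eq_intros)
  moreover have "(lift has_derivative tangent x) (at (?l 0))"
    using has_derivative_lift[OF x] by simp
  ultimately have "(lift \<circ> ?l has_derivative tangent x \<circ> (\<lambda>t. t *\<^sub>R w)) (at 0)"
    by (rule diff_chain_at)
  then show "((\<lambda>t. lift (x + t *\<^sub>R w)) has_derivative (\<lambda>t. t *\<^sub>R tangent x w)) (at 0)"
    using linear_cmul[OF linear_tangent] by (simp add: o_def)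
qed

text \<open>
  A curve in the graph is determined by its horizontal part, and its height moves with speed
  \<open>slope x \<bullet> w\<close> if the horizontal part has velocity \<open>w\<close>; conversely, straight segments
  in \<open>U\<close> lift to curves with every such velocity.
\<close>

lemma tangent_space_lift:
  assumes x: "x \<in> U"
  shows "tangent_space (lift ` U) (lift x) = range (tangent x)"
proof
  show "range (tangent x) \<subseteq> tangent_space (lift ` U) (lift x)"
  proof (rule image_subsetI)
    fix w
    obtain T where T: "open T" "0 \<in> T" "(\<lambda>t. lift (x + t *\<^sub>R w)) ` T \<subseteq> lift ` U"
      "((\<lambda>t. lift (x + t *\<^sub>R w)) has_derivative (\<lambda>t. t *\<^sub>R tangent x w)) (at 0)"
      using curve_in_graph[OF x] by blast
    have "\<forall>\<^sub>F t in at 0. lift (x + t *\<^sub>R w) \<in> lift ` U"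
      using eventually_at_in_open'[OF T(1,2)] T(3) by (auto elim!: eventually_mono)
    with T(4) show "tangent x w \<in> tangent_space (lift ` U) (lift x)"
      unfolding tangent_space_def has_vector_derivative_def
      by (auto intro!: exI[of _ "\<lambda>t. lift (x + t *\<^sub>R w)"])
  qed
  show "tangent_space (lift ` U) (lift x) \<subseteq> range (tangent x)"
  proof
    fix v assume "v \<in> tangent_space (lift ` U) (lift x)"
    then obtain \<gamma> where \<gamma>: "\<gamma> 0 = lift x" "\<forall>\<^sub>F t in at 0. \<gamma> t \<in> lift ` U"
        "(\<gamma> has_derivative (\<lambda>t. t *\<^sub>R v)) (at 0)"
      by (auto simp: tangent_space_def has_vector_derivative_def)
    have d1: "((\<lambda>t. fst (\<gamma> t)) has_derivative (\<lambda>t. t *\<^sub>R fst v)) (at 0)"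
      and d2: "((\<lambda>t. snd (\<gamma> t)) has_derivative (\<lambda>t. t *\<^sub>R snd v)) (at 0)"
      using has_derivative_fst[OF \<gamma>(3)] has_derivative_snd[OF \<gamma>(3)] by simp_all
    have "(height has_derivative (\<lambda>w. slope x \<bullet> w)) (at (fst (\<gamma> 0)))"
      using has_derivative_height[OF x] by (simp add: \<gamma>(1) lift_def)
    from diff_chain_at[OF d1 this]
    have d3: "((\<lambda>t. height (fst (\<gamma> t))) has_derivative (\<lambda>t. slope x \<bullet> (t *\<^sub>R fst v))) (at 0)"
      by (simp add: o_def)
    have "\<forall>\<^sub>F t in at 0. height (fst (\<gamma> t)) = snd (\<gamma> t)"
      using \<gamma>(2) by eventually_elim (auto simp: lift_def)
    moreover have "height (fst (\<gamma> 0)) = snd (\<gamma> 0)" by (simp add: \<gamma>(1) lift_def)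
    ultimately have "((\<lambda>t. snd (\<gamma> t)) has_derivative (\<lambda>t. slope x \<bullet> (t *\<^sub>R fst v))) (at 0)"
      using has_derivative_transform_eventually[OF d3] by simp
    with d2 have "(\<lambda>t. t *\<^sub>R snd v) = (\<lambda>t. slope x \<bullet> (t *\<^sub>R fst v))"
      by (rule has_derivative_unique)
    from fun_cong[OF this, of 1] have "v = tangent x (fst v)"
      by (simp add: tangent_def prod_eq_iff)
    then show "v \<in> range (tangent x)" by blast
  qed
qed

lemma continuous_on_slope: "continuous_on U slope"
  by (meson continuous_at_imp_continuous_on has_derivative_continuous has_derivative_slope)

lemma continuous_on_lift: "continuous_on U lift"
  by (meson continuous_at_imp_continuous_on has_derivative_continuous has_derivative_lift)

text \<open>
  At each point a unit normal is \<open>normal x\<close> up to a sign. The sign is continuous in \<open>x\<close>, hence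
  constant on the connected domain.
\<close>

lemma unit_normal_field_eq:
  assumes N: "unit_normal_field N (lift ` U)" and conn: "connected U"
  obtains \<epsilon> :: real where "\<epsilon> = 1 \<or> \<epsilon> = -1" "\<forall>x\<in>U. N (lift x) = \<epsilon> *\<^sub>R normal x"
proof (cases "U = {}")
  case True
  then show thesis using that[of 1] by simp
next
  case False
  define \<sigma> where "\<sigma> x = area x * snd (N (lift x))" for x
  have N\<sigma>: "N (lift x) = \<sigma> x *\<^sub>R normal x" if x: "x \<in> U" for x
  proof -
    have "N (lift x) \<bullet> tangent x w = 0" for w
      using N x by (auto simp: unit_normal_field_def tangent_space_lift)
    then have "(fst (N (lift x)) + snd (N (lift x)) *\<^sub>R slope x) \<bullet> w = 0" for w
      by (simp add: tangent_def inner_prod_def inner_add_left)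
    then have "fst (N (lift x)) + snd (N (lift x)) *\<^sub>R slope x = 0"
      using inner_eq_zero_iff by blast
    then have "fst (N (lift x)) = - snd (N (lift x)) *\<^sub>R slope x"
      by (simp add: eq_neg_iff_add_eq_0)
    then show ?thesis
      using area_pos[of x] by (simp add: \<sigma>_def normal_def prod_eq_iff)
  qed
  have \<sigma>1: "\<sigma> x \<in> {1, -1}" if x: "x \<in> U" for x
  proof -
    have "norm (N (lift x)) = 1"
      using N x by (auto simp: unit_normal_field_def)
    then have "\<bar>\<sigma> x\<bar> = 1" using N\<sigma>[OF x] norm_normal[of x] by simp
    then show ?thesis by auto
  qed
  have "continuous_on U (\<lambda>x. N (lift x))"
    using N continuous_on_lift continuous_on_compose2[of "lift ` U" N U lift]
    by (auto simp: unit_normal_field_def)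
  then have "continuous_on U \<sigma>"
    unfolding \<sigma>_def[abs_def] area_def[abs_def] by (intro continuous_intros continuous_on_slope)
  moreover have "finite (\<sigma> ` U)"
    using \<sigma>1 by (meson finite.emptyI finite.insertI finite_subset image_subsetI)
  ultimately have "\<sigma> constant_on U"
    by (intro continuous_finite_range_constant conn)
  then obtain \<epsilon> where \<epsilon>: "\<And>x. x \<in> U \<Longrightarrow> \<sigma> x = \<epsilon>"
    by (auto simp: constant_on_def)
  with False \<sigma>1 have "\<epsilon> = 1 \<or> \<epsilon> = -1" by force
  with N\<sigma> \<epsilon> that show thesis by metis
qed

text \<open>
  On the graph \<open>N\<close> agrees with a differentiable map of the ambient space, which provides one
  derivative of \<open>N\<close> within the graph. The one selected by \<open>frechet_derivative\<close> may differ from it, but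
  not on velocities of curves in the graph.
\<close>

lemma shape_operator_tangent:
  assumes N: "\<forall>x\<in>U. N (lift x) = \<epsilon> *\<^sub>R normal x" and x: "x \<in> U"
  shows "shape_operator N (lift ` U) (lift x) (tangent x w) = \<epsilon> *\<^sub>R tangent x (shape x w)"
proof -
  let ?M = "lift ` U"
  have "((\<lambda>p. \<epsilon> *\<^sub>R normal (fst p)) has_derivative (\<lambda>v. \<epsilon> *\<^sub>R - tangent x (shape x (fst v))))
      (at (lift x) within ?M)"
  proof -
    have "(normal has_derivative (\<lambda>w. - tangent x (shape x w))) (at (fst (lift x)))"
      using has_derivative_normal[OF x] by (simp add: lift_def)
    moreover have "(fst has_derivative fst) (at (lift x))"
      by (intro bounded_linear_imp_has_derivative bounded_linear_fst)
    ultimately have "(normal \<circ> fst has_derivative (\<lambda>w. - tangent x (shape x w)) \<circ> fst) (at (lift x))"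
      by (intro diff_chain_at)
    then have "((\<lambda>p. normal (fst p)) has_derivative (\<lambda>v. - tangent x (shape x (fst v))))
        (at (lift x) within ?M)"
      unfolding o_def by (rule has_derivative_at_withinI)
    then show ?thesis by (rule has_derivative_scaleR_right)
  qed
  then have D: "(N has_derivative (\<lambda>v. \<epsilon> *\<^sub>R - tangent x (shape x (fst v)))) (at (lift x) within ?M)"
    by (rule has_derivative_transform[rotated 2]) (use x N in \<open>auto simp: lift_def\<close>)
  define D' where "D' = frechet_derivative N (at (lift x) within ?M)"
  have D': "(N has_derivative D') (at (lift x) within ?M)"
    unfolding D'_def using D frechet_derivative_works differentiableI by blast
  \<comment> \<open>Both derivatives give the velocity of \<open>N\<close> along the lift of a segment with direction \<open>w\<close>.\<close>
  obtain T where T: "open T" "0 \<in> T" "(\<lambda>t. lift (x + t *\<^sub>R w)) ` T \<subseteq> ?M"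
    "((\<lambda>t. lift (x + t *\<^sub>R w)) has_derivative (\<lambda>t. t *\<^sub>R tangent x w)) (at 0)"
    using curve_in_graph[OF x] by blast
  have chain: "((\<lambda>t. N (lift (x + t *\<^sub>R w))) has_derivative (\<lambda>t. L (t *\<^sub>R tangent x w))) (at 0)"
    if "(N has_derivative L) (at (lift x) within ?M)" for L
  proof -
    have "(N has_derivative L) (at (lift (x + 0 *\<^sub>R w)) within (\<lambda>t. lift (x + t *\<^sub>R w)) ` T)"
      using has_derivative_subset[OF that T(3)] by simp
    from diff_chain_within[OF has_derivative_at_withinI[OF T(4)] this]
    show ?thesis
      using at_within_open[OF T(2,1)] by (simp add: o_def)
  qed
  have "(\<lambda>t. D' (t *\<^sub>R tangent x w)) = (\<lambda>t. \<epsilon> *\<^sub>R - tangent x (shape x (fst (t *\<^sub>R tangent x w))))"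
    by (rule has_derivative_unique[OF chain[OF D'] chain[OF D]])
  from fun_cong[OF this, of 1] show ?thesis
    by (simp add: shape_operator_def D'_def tangent_def)
qed

section \<open>The curvature of the graph in terms of slopes and second derivatives\<close>

text \<open>
  The generating function of the symmetric functions of the eigenvalues of \<open>\<epsilon> *\<^sub>R shape x\<close>,
  computed without knowing the eigenvalues.
\<close>

lemma det_one_plus_shape:
  "det (matrix (\<lambda>w. w + s *\<^sub>R (\<epsilon> *\<^sub>R shape x w)))
    = (\<Sum>J\<in>UNIV. s ^ card J * ((\<Prod>i\<in>J. \<epsilon> / area x * hess x $ i)
        * (1 - (\<Sum>k\<in>J. (slope x $ k)\<^sup>2 / (area x)\<^sup>2))))"
proof -
  define a where "a i = \<epsilon> / area x * hess x $ i" for i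
  have M: "matrix (\<lambda>w. w + s *\<^sub>R (\<epsilon> *\<^sub>R shape x w))
      = (\<chi> i. (1 + s * a i) *s axis i 1
          + (- s * \<epsilon> / (area x) ^ 3 * slope x $ i) *s (\<chi> j. slope x $ j * hess x $ j))"
    using area_pos[of x]
    by (auto simp: matrix_def vec_eq_iff shape_def a_def axis_def inner_vec_def if_distrib
        power2_eq_square power3_eq_cube cong: if_cong) (auto simp: field_simps)
  have coeff: "(- s * \<epsilon> / (area x) ^ 3 * slope x $ k) * (slope x $ k * hess x $ k)
      = - (s * a k * ((slope x $ k)\<^sup>2 / (area x)\<^sup>2))" for k
    using area_pos[of x] by (simp add: a_def power2_eq_square power3_eq_cube mult_ac)
  have "det (matrix (\<lambda>w. w + s *\<^sub>R (\<epsilon> *\<^sub>R shape x w)))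
      = (\<Prod>j\<in>UNIV. 1 + s * a j) + (\<Sum>k\<in>UNIV. (- s * \<epsilon> / (area x) ^ 3 * slope x $ k)
        * (slope x $ k * hess x $ k) * (\<Prod>j\<in>UNIV - {k}. 1 + s * a j))"
    unfolding M det_diagonal_plus_rank_one by (simp only: vec_lambda_beta)
  also have "\<dots> = (\<Prod>j\<in>UNIV. 1 + s * a j) - (\<Sum>k\<in>UNIV. s * a k * ((slope x $ k)\<^sup>2 / (area x)\<^sup>2)
      * (\<Prod>j\<in>UNIV - {k}. 1 + s * a j))"
    by (simp only: coeff) (simp add: sum_negf)
  finally show ?thesis
    unfolding a_def[symmetric] prod_one_plus_minus_derivative .
qed

text \<open>
  The second fundamental form of the graph; its symmetry is the self-adjointness of the shape
  operator.
\<close>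

lemma inner_tangent_shape:
  "tangent x (shape x w) \<bullet> tangent x w' = (hess x * w) \<bullet> w' / area x"
  using area_pos[of x]
  by (simp add: tangent_def slope_inner_shape)
    (simp add: shape_def inner_diff_left power2_eq_square power3_eq_cube field_simps)

text \<open>
  The spectral theorem on the tangent space, read off in the parameter space. Besides giving the
  eigenvectors that diagonalise \<open>\<epsilon> *\<^sub>R shape x\<close>, it shows that a family with the multiplicities
  that define the principal curvatures exists at all.
\<close>

lemma principal_eigenbasis:
  assumes N: "\<forall>x\<in>U. N (lift x) = \<epsilon> *\<^sub>R normal x" and x: "x \<in> U"
  obtains w :: "'n \<Rightarrow> real ^ 'n" and \<mu> :: "'n \<Rightarrow> real"
  where "\<And>c. (\<Sum>i\<in>UNIV. c i *\<^sub>R w i) = 0 \<Longrightarrow> \<forall>i. c i = 0"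
    and "\<And>i. \<epsilon> *\<^sub>R shape x (w i) = \<mu> i *\<^sub>R w i"
    and "\<And>\<kappa>. card {i. \<mu> i = \<kappa>} = dim (principal_space N (lift ` U) (lift x) \<kappa>)"
proof -
  interpret t: linear "tangent x" by (rule linear_tangent)
  define A where "A v = \<epsilon> *\<^sub>R tangent x (shape x (fst v))" for v :: "(real ^ 'n) \<times> real"
  define T where "T = range (tangent x)"
  have A_tangent: "A (tangent x w) = \<epsilon> *\<^sub>R tangent x (shape x w)" for w
    by (simp add: A_def tangent_def)
  have A: "linear A"
  proof -
    have "linear (\<lambda>v. tangent x (shape x (fst v)))"
      using linear_compose[OF linear_compose[OF linear_fst linear_shape] linear_tangent]
      by (simp add: o_def)
    then show ?thesis
      unfolding A_def[abs_def] by (rule linear_compose_scale_right)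
  qed
  have T: "subspace T"
    unfolding T_def by (rule linear_subspace_image[OF linear_tangent subspace_UNIV])
  have dimT: "dim T = CARD('n)"
    unfolding T_def using dim_image_eq[OF linear_tangent, where S = UNIV] inj_tangent by simp
  have "A v \<in> T" if "v \<in> T" for v
    using that by (auto simp: T_def A_tangent t.scale[symmetric])
  moreover have "A v \<bullet> v' = v \<bullet> A v'" if "v \<in> T" "v' \<in> T" for v v'
  proof -
    obtain w w' where "v = tangent x w" "v' = tangent x w'"
      using \<open>v \<in> T\<close> \<open>v' \<in> T\<close> unfolding T_def by blast
    moreover have "(hess x * w) \<bullet> w' = (hess x * w') \<bullet> w"
      by (simp add: inner_vec_def mult_ac)
    ultimately show ?thesis
      by (simp add: A_tangent inner_tangent_shape inner_commute[of "tangent x w"])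
  qed
  ultimately obtain B where B: "independent B" "span B = T" "\<forall>b\<in>B. \<exists>\<kappa>. A b = \<kappa> *\<^sub>R b"
    using self_adjoint_on_eigenbasis[OF A T] by blast
  have "finite B" "card B = CARD('n)"
    using B(1,2) dimT dim_span[of B] dim_eq_card_independent[of B] by (auto simp: independent_imp_finite)
  then obtain b :: "'n \<Rightarrow> _" where "bij_betw b UNIV B"
    using finite_same_card_bij[of "UNIV :: 'n set" B] by auto
  then have b: "inj b" "range b = B" by (auto simp: bij_betw_def)
  have "\<forall>i. \<exists>\<kappa>. A (b i) = \<kappa> *\<^sub>R b i"
    using B(3) b(2) by auto
  then obtain \<mu> where \<mu>: "\<And>i. A (b i) = \<mu> i *\<^sub>R b i"
    by (elim choice[elim_format] exE) blast
  have bT: "b i = tangent x (fst (b i))" for i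
    using B(2) span_base[of "b i" B] b(2) by (auto simp: T_def tangent_def)
  show thesis
  proof
    fix c assume c: "(\<Sum>i\<in>UNIV. c i *\<^sub>R fst (b i)) = 0"
    have "(\<Sum>i\<in>UNIV. c i *\<^sub>R b i) = tangent x (\<Sum>i\<in>UNIV. c i *\<^sub>R fst (b i))"
      by (subst bT) (simp add: t.sum t.scale)
    then have "(\<Sum>i\<in>UNIV. c i *\<^sub>R b i) = 0" by (simp add: c t.zero)
    then show "\<forall>i. c i = 0"
      using independent_range_coeffs_zero[OF b(1)] B(1) b(2) by blast
  next
    fix i
    have "tangent x (\<epsilon> *\<^sub>R shape x (fst (b i))) = \<mu> i *\<^sub>R b i"
      using \<mu>[of i] by (simp add: A_def t.scale)
    from arg_cong[OF this, of fst]
    show "\<epsilon> *\<^sub>R shape x (fst (b i)) = \<mu> i *\<^sub>R fst (b i)"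
      by (simp add: tangent_def)
  next
    fix \<kappa>
    have "principal_space N (lift ` U) (lift x) \<kappa> = {v \<in> T. A v = \<kappa> *\<^sub>R v}"
      unfolding principal_space_def tangent_space_lift[OF x] T_def
      by (auto simp: shape_operator_tangent[OF N x] A_tangent)
    then show "card {i. \<mu> i = \<kappa>} = dim (principal_space N (lift ` U) (lift x) \<kappa>)"
      using dim_eigenspace[OF A b(1) _ \<mu>, of \<kappa>] B(1,2) b(2) by simp
  qed
qed

text \<open>
  Both the eigenbasis and the rank-one structure compute the determinant of the identity plus
  \<open>s\<close> times the shape operator; compare the coefficients of \<open>s ^ r\<close>.
\<close>

lemma S_curvature_lift:
  assumes N: "\<forall>x\<in>U. N (lift x) = \<epsilon> *\<^sub>R normal x" and x: "x \<in> U"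
  shows "S_curvature r N (lift ` U) (lift x) * area x ^ (r + 2)
    = \<epsilon> ^ r * curvature_form r (\<lambda>i. hess x $ i) (\<lambda>i. slope x $ i)"
proof -
  let ?\<kappa> = "principal_curvatures N (lift ` U) (lift x)"
  obtain w :: "'n \<Rightarrow> real ^ 'n" and \<mu> :: "'n \<Rightarrow> real"
    where indep: "\<And>c. (\<Sum>i\<in>UNIV. c i *\<^sub>R w i) = 0 \<Longrightarrow> \<forall>i. c i = 0"
    and eig: "\<And>i. \<epsilon> *\<^sub>R shape x (w i) = \<mu> i *\<^sub>R w i"
    and mult: "\<And>\<kappa>. card {i. \<mu> i = \<kappa>} = dim (principal_space N (lift ` U) (lift x) \<kappa>)"
    by (rule principal_eigenbasis[OF N x], rule that)
  have "\<forall>\<kappa>. card {i. ?\<kappa> i = \<kappa>} = dim (principal_space N (lift ` U) (lift x) \<kappa>)"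
    unfolding principal_curvatures_def by (rule someI[of _ \<mu>]) (simp add: mult)
  then have "(\<Prod>i\<in>UNIV. 1 + s * ?\<kappa> i) = (\<Prod>i\<in>UNIV. 1 + s * \<mu> i)" for s
    using prod_eq_if_multiplicities_eq[of ?\<kappa> \<mu> "\<lambda>\<kappa>. 1 + s * \<kappa>"] mult by simp
  moreover have "det (matrix (\<lambda>w. w + s *\<^sub>R (\<epsilon> *\<^sub>R shape x w))) = (\<Prod>i\<in>UNIV. 1 + s * \<mu> i)" for s
  proof (rule det_eigenbasis[OF _ indep])
    show "linear (\<lambda>w. w + s *\<^sub>R (\<epsilon> *\<^sub>R shape x w))"
      by (intro linear_compose_add linear_ident linear_compose_scale_right linear_shape)
    show "w i + s *\<^sub>R (\<epsilon> *\<^sub>R shape x (w i)) = (1 + s * \<mu> i) *\<^sub>R w i" for i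
      unfolding eig by (simp add: scaleR_left_distrib)
  qed
  ultimately have "(\<Sum>J\<in>UNIV. s ^ card J * (\<Prod>i\<in>J. ?\<kappa> i))
    = (\<Sum>J\<in>UNIV. s ^ card J * ((\<Prod>i\<in>J. \<epsilon> / area x * hess x $ i)
        * (1 - (\<Sum>k\<in>J. (slope x $ k)\<^sup>2 / (area x)\<^sup>2))))" for s
    by (simp only: det_one_plus_shape[symmetric] prod_one_plus[symmetric])
  then have S: "S_curvature r N (lift ` U) (lift x) = (\<Sum>J | card J = r. (\<Prod>i\<in>J. \<epsilon> / area x * hess x $ i)
        * (1 - (\<Sum>k\<in>J. (slope x $ k)\<^sup>2 / (area x)\<^sup>2)))"
    unfolding S_curvature_def by (rule sum_subsets_eq_if_generating_functions_eq)
  have summand: "(\<Prod>i\<in>J. \<epsilon> / area x * hess x $ i) * (1 - (\<Sum>k\<in>J. (slope x $ k)\<^sup>2 / (area x)\<^sup>2))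
      * area x ^ (r + 2) = \<epsilon> ^ r * ((\<Prod>i\<in>J. hess x $ i) * (1 + (\<Sum>m\<in>-J. (slope x $ m)\<^sup>2)))"
    if J: "card J = r" for J
  proof -
    have split: "u * v * z ^ (r + 2) = (u * z ^ r) * (v * z\<^sup>2)" for u v z :: real
      by (simp add: power_add power2_eq_square)
    have 1: "(\<Prod>i\<in>J. \<epsilon> / area x * hess x $ i) * area x ^ r = \<epsilon> ^ r * (\<Prod>i\<in>J. hess x $ i)"
      using area_pos[of x] by (simp add: prod.distrib prod_dividef J)
    have 2: "(1 - (\<Sum>k\<in>J. (slope x $ k)\<^sup>2 / (area x)\<^sup>2)) * (area x)\<^sup>2
        = (area x)\<^sup>2 - (\<Sum>k\<in>J. (slope x $ k)\<^sup>2)"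
      using area_pos[of x] by (simp add: sum_divide_distrib[symmetric] left_diff_distrib)
    have 3: "(area x)\<^sup>2 = 1 + (\<Sum>k\<in>J. (slope x $ k)\<^sup>2) + (\<Sum>k\<in>-J. (slope x $ k)\<^sup>2)"
      using sum.union_disjoint[of J "-J" "\<lambda>k. (slope x $ k)\<^sup>2"]
      unfolding area_squared inner_vec_def by (simp add: power2_eq_square Compl_partition)
    have 4: "(area x)\<^sup>2 - (\<Sum>k\<in>J. (slope x $ k)\<^sup>2) = 1 + (\<Sum>k\<in>-J. (slope x $ k)\<^sup>2)"
      unfolding 3 by simp
    show ?thesis unfolding split 1 2 4 by (rule mult.assoc)
  qed
  show ?thesis
    unfolding S curvature_form_def sum_distrib_left sum_distrib_right
    by (intro sum.cong refl) (simp only: mem_Collect_eq summand)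
qed

section \<open>Constant curvature\<close>

text \<open>
  Only two coordinates with nonvanishing second derivative are varied, all others being kept at
  their values at a point \<open>p\<close>.
\<close>

lemma constant_curvature_form_zero:
  assumes r: "2 < r"
    and eq: "\<And>x. x \<in> U \<Longrightarrow> curvature_form r (\<lambda>i. hess x $ i) (\<lambda>i. slope x $ i) = c * area x ^ (r + 2)"
    and U: "U \<noteq> {}"
  shows "c = 0"
proof (rule ccontr)
  assume c: "c \<noteq> 0"
  obtain p where p: "p \<in> U" using U by blast
  have "curvature_form r (\<lambda>i. hess p $ i) (\<lambda>i. slope p $ i) \<noteq> 0"
    using eq[OF p] c area_pos[of p] by simp
  then obtain J where J: "card J = r" "(\<Prod>i\<in>J. hess p $ i) \<noteq> 0"
    unfolding curvature_form_def by (metis (mono_tags, lifting) mem_Collect_eq mult_zero_left sum.neutral)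
  have "\<not> card J \<le> 1" using J(1) r by simp
  then obtain i j where ij: "i \<in> J" "j \<in> J" "i \<noteq> j"
    using card_le_Suc0_iff_eq[of J] by auto
  have hi: "hess p $ i \<noteq> 0" and hj: "hess p $ j \<noteq> 0"
    using J(2) ij by (auto simp: prod_zero_iff)
  obtain e where e: "e > 0" "ball p e \<subseteq> U"
    using open_U p by (meson open_contains_ball)
  define \<delta> where "\<delta> = e / 2"
  \<comment> \<open>The radius \<open>\<delta>\<close> leaves room for moving both coordinates within the ball around \<open>p\<close>.\<close>
  define X where "X s u = (\<chi> k. if k = i then s else if k = j then u else p $ k)" for s u
  have XU: "X s u \<in> U" if "s \<in> ball (p $ i) \<delta>" "u \<in> ball (p $ j) \<delta>" for s u
  proof -
    have "X s u - p = (s - p $ i) *\<^sub>R axis i 1 + (u - p $ j) *\<^sub>R axis j 1"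
      using ij(3) by (auto simp: X_def vec_eq_iff axis_def)
    then have "norm (X s u - p) \<le> \<bar>s - p $ i\<bar> + \<bar>u - p $ j\<bar>"
      using norm_triangle_ineq[of "(s - p $ i) *\<^sub>R axis i 1" "(u - p $ j) *\<^sub>R axis j (1::real)"]
      by simp
    also have "\<dots> < e" using that unfolding mem_ball dist_real_def \<delta>_def by linarith
    finally show ?thesis using e(2) by (auto simp: dist_norm norm_minus_commute)
  qed
  define g where "g k = deriv (f k)" for k
  define b where "b u = 1 + (\<Sum>k\<in>UNIV - {i, j}. (g k (p $ k))\<^sup>2) + (g j u)\<^sup>2" for u
  define h0 where "h0 u k = deriv (g k) (if k = j then u else p $ k)" for u k
  define g0 where "g0 u k = g k (if k = j then u else p $ k)" for u k
  have hess_X: "(\<lambda>k. hess (X s u) $ k) = (h0 u)(i := deriv (g i) s)" for s u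
    by (auto simp: hess_def X_def g_def h0_def)
  have slope_X: "(\<lambda>k. slope (X s u) $ k) = (g0 u)(i := g i s)" for s u
    by (auto simp: slope_def X_def g_def g0_def)
  have "\<forall>u. \<exists>P Q E. \<forall>x y. curvature_form r ((h0 u)(i := x)) ((g0 u)(i := y)) = x * P + Q + y\<^sup>2 * E"
    by (intro allI curvature_form_one_variable)
  then obtain P Q E where PQE:
      "\<And>u x y. curvature_form r ((h0 u)(i := x)) ((g0 u)(i := y)) = x * P u + Q u + y\<^sup>2 * E u"
    by metis
  have area: "area (X s u) ^ (r + 2) = (b u + (g i s)\<^sup>2) powr (real (r + 2) / 2)" for s u
  proof -
    have "(area (X s u))\<^sup>2 = 1 + (\<Sum>k\<in>UNIV. (slope (X s u) $ k)\<^sup>2)"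
      unfolding area_squared inner_vec_def by (simp add: power2_eq_square)
    also have "(\<Sum>k\<in>UNIV. (slope (X s u) $ k)\<^sup>2)
        = (g i s)\<^sup>2 + ((g j u)\<^sup>2 + (\<Sum>k\<in>UNIV - {i} - {j}. (slope (X s u) $ k)\<^sup>2))"
      using ij(3) by (simp add: sum.remove[of UNIV i] sum.remove[of "UNIV - {i}" j] slope_def X_def g_def)
    also have "(\<Sum>k\<in>UNIV - {i} - {j}. (slope (X s u) $ k)\<^sup>2) = (\<Sum>k\<in>UNIV - {i, j}. (g k (p $ k))\<^sup>2)"
      by (intro sum.cong) (auto simp: slope_def X_def g_def)
    finally have sq: "(area (X s u))\<^sup>2 = b u + (g i s)\<^sup>2" by (simp add: b_def)
    have "area (X s u) ^ (r + 2) = area (X s u) powr real (r + 2)"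
      by (rule powr_realpow[symmetric]) (rule area_pos)
    also have "\<dots> = area (X s u) powr (2 * (real (r + 2) / 2))"
      by (simp only: mult_2 field_sum_of_halves)
    also have "\<dots> = (area (X s u) powr 2) powr (real (r + 2) / 2)"
      by (rule powr_powr[symmetric])
    also have "area (X s u) powr 2 = (area (X s u))\<^sup>2"
      using area_pos[of "X s u"] by simp
    finally show ?thesis by (simp add: sq)
  qed
  have interval: "\<exists>\<alpha> \<beta>. 0 \<le> \<alpha> \<and> \<alpha> < \<beta> \<and> {\<alpha>..\<beta>} \<subseteq> (\<lambda>s. (g k s)\<^sup>2) ` ball (p $ k) \<delta>"
    if k: "k = i \<or> k = j" for k
  proof -
    have "continuous_on (ball (p $ k) \<delta>) (g k)"
    proof (intro continuous_at_imp_continuous_on ballI)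
      fix s assume s: "s \<in> ball (p $ k) \<delta>"
      have "\<exists>x\<in>U. s = x $ k"
      proof (cases "k = i")
        case True
        then show ?thesis
          using XU[of s "p $ j"] s e(1) by (intro bexI[of _ "X s (p $ j)"]) (simp_all add: X_def \<delta>_def)
      next
        case False
        with k have "k = j" by simp
        then show ?thesis
          using XU[of "p $ i" s] s e(1) ij(3)
          by (intro bexI[of _ "X (p $ i) s"]) (simp_all add: X_def \<delta>_def)
      qed
      then show "isCont (g k) s"
        unfolding g_def using deriv_slope DERIV_isCont by blast
    qed
    moreover have "\<delta> > 0" using e(1) by (simp add: \<delta>_def)
    moreover have "(g k has_real_derivative hess p $ k) (at (p $ k))"
      unfolding g_def by (rule deriv_slope[OF p])
    moreover have "hess p $ k \<noteq> 0" using k hi hj by blast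
    ultimately show ?thesis by (metis square_image_contains_interval)
  qed
  obtain \<alpha> \<beta> where \<alpha>: "0 \<le> \<alpha>" "\<alpha> < \<beta>" "{\<alpha>..\<beta>} \<subseteq> (\<lambda>s. (g i s)\<^sup>2) ` ball (p $ i) \<delta>"
    using interval[of i] by blast
  obtain \<alpha>' \<beta>' where \<alpha>': "\<alpha>' < \<beta>'" "{\<alpha>'..\<beta>'} \<subseteq> (\<lambda>s. (g j s)\<^sup>2) ` ball (p $ j) \<delta>"
    using interval[of j] by blast
  have "infinite ((\<lambda>s. (g j s)\<^sup>2) ` ball (p $ j) \<delta>)"
    using \<alpha>' infinite_Icc infinite_super by blast
  moreover have "(\<lambda>s. (g j s)\<^sup>2) ` ball (p $ j) \<delta>
      = (\<lambda>y. y - (1 + (\<Sum>k\<in>UNIV - {i, j}. (g k (p $ k))\<^sup>2))) ` b ` ball (p $ j) \<delta>"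
    by (simp add: b_def image_image)
  ultimately have "infinite (b ` ball (p $ j) \<delta>)"
    using finite_imageI by fastforce
  moreover have "b u > 0" for u
    unfolding b_def by (intro add_pos_nonneg sum_nonneg) auto
  moreover have "deriv (g i) s * P u + Q u + (g i s)\<^sup>2 * E u = c * (b u + (g i s)\<^sup>2) powr (real (r + 2) / 2)"
    if "s \<in> ball (p $ i) \<delta>" "u \<in> ball (p $ j) \<delta>" for s u
    using eq[OF XU[OF that]] unfolding hess_X slope_X PQE area .
  moreover have "2 < real (r + 2) / 2" using r by simp
  ultimately have "c = 0"
    using separated_equation_constant_zero[of "ball (p $ i) \<delta>" "ball (p $ j) \<delta>" "deriv (g i)" P Q
        "\<lambda>s. (g i s)\<^sup>2" E c b "real (r + 2) / 2" \<alpha> \<beta>] \<alpha> by blast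
  with c show False by blast
qed

end

theorem theorem2:
  fixes M :: "((real ^ 'n) \<times> real) set"
    and N :: "(real ^ 'n) \<times> real \<Rightarrow> (real ^ 'n) \<times> real"
    and r :: nat
  assumes "CARD('n) \<ge> 3"
    and "2 < r" and "r < CARD('n)"
    and "translation_hypersurface M"
    and "unit_normal_field N M"
    and "S_curvature r N M constant_on M"
  shows "\<forall>p\<in>M. S_curvature r N M p = 0"
proof -
  obtain U f where U: "open U" "connected U" "U \<noteq> {}"
    and f: "\<And>i. smooth_real_on (f i) ((\<lambda>x. x $ i) ` U)"
    and M: "M = (\<lambda>x. (x, \<Sum>i\<in>UNIV. f i (x $ i))) ` U"
    using assms(4) unfolding translation_hypersurface_def by blast
  interpret translation_graph U f
    by unfold_locales (use U f in auto)
  have M: "M = lift ` U"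
    by (simp add: M lift_def[abs_def] height_def)
  obtain \<epsilon> :: real where \<epsilon>: "\<epsilon> = 1 \<or> \<epsilon> = -1"
    and N: "\<forall>x\<in>U. N (lift x) = \<epsilon> *\<^sub>R normal x"
    using unit_normal_field_eq[OF _ U(2)] assms(5) unfolding M by blast
  obtain c where c: "\<And>x. x \<in> U \<Longrightarrow> S_curvature r N M (lift x) = c"
    using assms(6) unfolding M constant_on_def by blast
  have "curvature_form r (\<lambda>i. hess x $ i) (\<lambda>i. slope x $ i) = (\<epsilon> ^ r * c) * area x ^ (r + 2)"
    if x: "x \<in> U" for x
  proof -
    have "\<epsilon> ^ r * \<epsilon> ^ r = 1" using \<epsilon> by (auto simp: power_mult_distrib[symmetric])
    then have "\<epsilon> ^ r * (\<epsilon> ^ r * z) = z" for z by (simp flip: mult.assoc)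
    moreover have "c * area x ^ (r + 2)
        = \<epsilon> ^ r * curvature_form r (\<lambda>i. hess x $ i) (\<lambda>i. slope x $ i)"
      using S_curvature_lift[OF N x, of r] c[OF x] by (simp add: M)
    ultimately show ?thesis by (metis mult.assoc)
  qed
  then have "\<epsilon> ^ r * c = 0"
    using constant_curvature_form_zero assms(2) U(3) by blast
  then have "c = 0" using \<epsilon> by auto
  then show ?thesis using c by (auto simp: M)
qed

end
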